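(* Let $d=2s+1$ be odd, $\mathcal{A}\in\mathrm{S}^d(\mathbb{R}^2)$, $T=\begin{pmatrix}1&1\\0&1\end{pmatrix}$, and $y=(y_0,\dots,y_{2s+1})=\mathfrak{B}(\mathscr{L}_T(\mathcal{A}))$. Assume $y_0>0$, $H_3(y)\succeq0$, $H_4(y)\succeq0$, and let $r=\operatorname{rank}H_1(y)$. Then: (i) The linear system in unknowns $g_0,\dots,g_{r-1}$ $$\sum_{j=0}^{r-1}y_{i+j}\,g_j=y_{i+r}\qquad(i=0,1,\dots,2s+1-r)$$ has a unique solution. (ii) For this solution, the polynomial $g(x)=g_0+g_1x+\cdots+g_{r-1}x^{r-1}-x^r$ has $r$ roots $x_1,\dots,x_r$ which are all distinct and belong to $[0,1]$, and there exists a unique vector $(\lambda_1,\dots,\lambda_r)$ with all $\lambda_i>0$ satisfying $y=\lambda_1[x_1]_d+\cdots+\lambda_r[x_r]_d$. Consequently $$\mathcal{A}=\begin{pmatrix}a_1\\ b_1\end{pmatrix}^{\otimes d}+\cdots+\begin{pmatrix}a_r\\ b_r\end{pmatrix}^{\otimes d},\quad a_i=\lambda_i^{1/d}(1-x_i)\ge0,\ b_i=\lambda_i^{1/d}x_i\ge0.$$ (iii) The $r$-atomic representing measure for $y$ is unique. (iv) The cp-rank of $\mathcal{A}$ is $r$, and the cp-rank decomposition given in (ii) is the unique cp-rank decomposition of $\mathcal{A}$.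
   Context: $\mathrm{S}^d(\mathbb{R}^2)$ is the space of real symmetric tensors of order $d$ and dimension $2$; $v^{\otimes d}$ has entries $v_{i_1}\cdots v_{i_d}$. $\mathscr{L}_T$ is the linear map $(\mathscr{L}_T\mathcal{X})_{i_1\dots i_d}=\sum_{j_1,\dots,j_d}T_{i_1j_1}\cdots T_{i_dj_d}\mathcal{X}_{j_1\dots j_d}$. For $\mathcal{X}\in\mathrm{S}^d(\mathbb{R}^2)$, $\mathfrak{B}(\mathcal{X})=(x_0,\dots,x_d)$ with $x_k=\mathcal{X}_{i_1\dots i_d}$ whenever $i_1+\cdots+i_d-d=k$. $[t]_d:=(1,t,\dots,t^d)$. $X\succeq0$ means positive semidefinite. With indices from $0$: $H_1(y)=(y_{i+j})_{0\le i,j\le s}$, $H_3(y)=(y_{i+j+1})_{0\le i,j\le s}$, $H_4(y)=(y_{i+j}-y_{i+j+1})_{0\le i,j\le s}$. A representing measure for $y=(y_0,\dots,y_d)$ is a Borel measure $\mu$ on $\mathbb{R}$ with $y_k=\int x^k\,d\mu$ for $k=0,\dots,d$; it is $r$-atomic if its support has exactly $r$ points. A cp-decomposition of $\mathcal{A}$ is an expression $\mathcal{A}=\sum_{i=1}^r v_i^{\otimes d}$ with $v_i\in\mathbb{R}^2_+$; the cp-rank is the smallest such $r$, and a cp-decomposition of that length is a cp-rank decomposition (uniqueness is up to reordering of summands). *)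

theory Defs
  imports "HOL-Analysis.Analysis" "HOL-Computational_Algebra.Polynomial" "Jordan_Normal_Form.DL_Rank"
begin

definition idx :: "nat \<Rightarrow> nat list set" where
  "idx d = {xs. length xs = d \<and> set xs \<subseteq> {1,2}}"

text \<open>Tensors are functions on index lists, vanishing outside idx d.
  Symmetric tensors of order d, dimension 2:\<close>
definition sym_tensor :: "nat \<Rightarrow> (nat list \<Rightarrow> real) \<Rightarrow> bool" where
  "sym_tensor d X \<longleftrightarrow>
     (\<forall>xs ys. xs \<in> idx d \<and> ys \<in> idx d \<and> mset xs = mset ys \<longrightarrow> X xs = X ys) \<and>
     (\<forall>xs. xs \<notin> idx d \<longrightarrow> X xs = 0)"

definition comp2 :: "real \<times> real \<Rightarrow> nat \<Rightarrow> real" where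
  "comp2 v i = (if i = 1 then fst v else snd v)"

definition tpow :: "nat \<Rightarrow> real \<times> real \<Rightarrow> nat list \<Rightarrow> real" where
  "tpow d v xs = (if xs \<in> idx d then prod_list (map (comp2 v) xs) else 0)"

definition Tmat :: "nat \<Rightarrow> nat \<Rightarrow> real" where
  "Tmat i j = (if i = 2 \<and> j = 1 then 0 else 1)"

definition LT :: "nat \<Rightarrow> (nat list \<Rightarrow> real) \<Rightarrow> nat list \<Rightarrow> real" where
  "LT d X xs = (if xs \<in> idx d then
      (\<Sum>js\<in>idx d. (\<Prod>k<d. Tmat (xs!k) (js!k)) * X js) else 0)"

text \<open>B(X)_k = entry with index sum d + k, i.e. k indices equal to 2.\<close>
definition Bvec :: "nat \<Rightarrow> (nat list \<Rightarrow> real) \<Rightarrow> nat \<Rightarrow> real" where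
  "Bvec d X k = X (replicate (d - k) 1 @ replicate k 2)"

definition psd :: "nat \<Rightarrow> (nat \<Rightarrow> nat \<Rightarrow> real) \<Rightarrow> bool" where
  "psd s M \<longleftrightarrow> (\<forall>c :: nat \<Rightarrow> real. (\<Sum>i\<le>s. \<Sum>j\<le>s. c i * M i j * c j) \<ge> 0)"

definition H1 :: "(nat \<Rightarrow> real) \<Rightarrow> nat \<Rightarrow> nat \<Rightarrow> real" where "H1 y i j = y (i + j)"
definition H3 :: "(nat \<Rightarrow> real) \<Rightarrow> nat \<Rightarrow> nat \<Rightarrow> real" where "H3 y i j = y (i + j + 1)"
definition H4 :: "(nat \<Rightarrow> real) \<Rightarrow> nat \<Rightarrow> nat \<Rightarrow> real" where "H4 y i j = y (i + j) - y (i + j + 1)"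

definition mat_rank :: "nat \<Rightarrow> (nat \<Rightarrow> nat \<Rightarrow> real) \<Rightarrow> nat" where
  "mat_rank s M = vec_space.rank (s + 1) (Matrix.mat (s + 1) (s + 1) (\<lambda>(i, j). M i j))"

definition cp_decomp :: "nat \<Rightarrow> (nat list \<Rightarrow> real) \<Rightarrow> (real \<times> real) list \<Rightarrow> bool" where
  "cp_decomp d A vs \<longleftrightarrow> (\<forall>v\<in>set vs. fst v \<ge> 0 \<and> snd v \<ge> 0) \<and>
      A = (\<lambda>xs. \<Sum>v\<leftarrow>vs. tpow d v xs)"

definition cp_rank :: "nat \<Rightarrow> (nat list \<Rightarrow> real) \<Rightarrow> nat" where
  "cp_rank d A = (LEAST r. \<exists>vs. length vs = r \<and> cp_decomp d A vs)"

definition msupport :: "real measure \<Rightarrow> real set" where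
  "msupport \<mu> = {x. \<forall>e>0. emeasure \<mu> (ball x e) > 0}"

definition representing :: "nat \<Rightarrow> (nat \<Rightarrow> real) \<Rightarrow> real measure \<Rightarrow> bool" where
  "representing d y \<mu> \<longleftrightarrow> sets \<mu> = sets borel \<and>
     (\<forall>k\<le>d. integrable \<mu> (\<lambda>x. x ^ k) \<and> y k = (\<integral>x. x ^ k \<partial>\<mu>))"

definition atomic :: "nat \<Rightarrow> real measure \<Rightarrow> bool" where
  "atomic r \<mu> \<longleftrightarrow> finite (msupport \<mu>) \<and> card (msupport \<mu>) = r"

end

theory Submission
  imports Defs "HOL-Computational_Algebra.Fundamental_Theorem_Algebra"
begin

text \<open>
  Let \<open>L\<close> be the linear functional with \<open>L x\<^sup>k = y\<^sub>k\<close> on polynomials of degree at most \<open>2s + 1\<close>.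
  The two positivity assumptions say \<open>L (x p\<^sup>2) \<ge> 0\<close> and \<open>L ((1 - x) p\<^sup>2) \<ge> 0\<close> for \<open>deg p \<le> s\<close>.
  Take \<open>p\<close> monic of least degree \<open>r\<close> with \<open>L (p\<^sup>2) = 0\<close> (or, if \<open>L\<close> is positive definite up to degree \<open>s\<close>,
  the orthogonal polynomial of degree \<open>s + 1\<close>).  Then \<open>L (p q) = 0\<close> whenever \<open>deg q + r \<le> 2s + 1\<close>, while
  \<open>L (h\<^sup>2) > 0\<close> for nonzero \<open>h\<close> of degree below \<open>r\<close>.  Testing \<open>p\<close> against its own cofactors shows that its
  roots are real, simple and in \<open>[0, 1]\<close>; Lagrange interpolation at these roots is a Gauss quadrature for \<open>L\<close>,
  with weights \<open>L \<ell>\<^sub>x = L (\<ell>\<^sub>x\<^sup>2) > 0\<close>.  Any representation of \<open>y\<close> by at most \<open>r\<close> nodes has a node polynomial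
  orthogonal to all lower degrees, which forces it to be \<open>p\<close>.
  Tensors translate to moments because \<open>L\<^sub>T\<close> sends \<open>(a, b)\<close> to \<open>(a + b, b)\<close> and a symmetric tensor is
  determined by its image under \<open>L\<^sub>T\<close>: a nonnegative rank-one term is the atom of weight \<open>(a + b)\<^sup>d\<close> at \<open>b / (a + b)\<close>.
\<close>

section \<open>Functionals that are nonnegative on the unit interval\<close>

locale hausdorff_functional =
  fixes L :: "real poly \<Rightarrow> real" and s :: nat
  assumes add: "L (p + q) = L p + L q"
    and smult: "L (Polynomial.smult c p) = c * L p"
    and x_nonneg: "degree p \<le> s \<Longrightarrow> L ([:0, 1:] * (p * p)) \<ge> 0"
    and one_minus_x_nonneg: "degree p \<le> s \<Longrightarrow> L ([:1, -1:] * (p * p)) \<ge> 0"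
begin

lemma zero [simp]: "L 0 = 0"
  using smult[of 0 0] by simp

lemma minus: "L (- p) = - L p"
  using smult[of "-1" p] by simp

lemma diff: "L (p - q) = L p - L q"
  using add[of p "- q"] by (simp add: minus)

lemma sum: "L (\<Sum>i\<in>I. f i) = (\<Sum>i\<in>I. L (f i))"
  by (induction I rule: infinite_finite_induct) (auto simp: add)

lemma nonneg_split: "L (p * p) = L ([:0, 1:] * (p * p)) + L ([:1, -1:] * (p * p))"
proof -
  have "[:0, 1:] + [:1, -1:] = (1 :: real poly)" by (simp add: one_pCons)
  then show ?thesis by (metis add distrib_right mult_1)
qed

lemma nonneg: "degree p \<le> s \<Longrightarrow> L (p * p) \<ge> 0"
  using x_nonneg[of p] one_minus_x_nonneg[of p] nonneg_split[of p] by linarith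

text \<open>If \<open>L (w * (p * p)) = 0\<close>, then evaluating at \<open>t p + q\<close> leaves
  an affine function of \<open>t\<close>, with slope twice \<open>L (w * (p * q))\<close>. An affine
  function that is nonnegative everywhere has slope zero. The weight \<open>w\<close> lets the
  argument run with both 1 and x.\<close>

lemma null_orthogonal:
  assumes p: "degree p \<le> s" "L (w * (p * p)) = 0" and q: "degree q \<le> s"
    and w: "\<And>f. degree f \<le> s \<Longrightarrow> L (w * (f * f)) \<ge> 0"
  shows "L (w * (p * q)) = 0"
proof (rule ccontr)
  define b c where "b = L (w * (p * q))" and "c = L (w * (q * q))"
  assume "L (w * (p * q)) \<noteq> 0"
  then have "b \<noteq> 0" by (simp add: b_def)
  have c0: "c \<ge> 0" using w[OF q] by (simp add: c_def)
  \<comment> \<open>Chosen so that \<open>2 * t * b + c\<close> becomes \<open>- c - 2\<close>,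
    which is negative.\<close>
  define t where "t = - (c + 1) / b"
  have "L (w * ((Polynomial.smult t p + q) * (Polynomial.smult t p + q))) = 2 * t * b + c"
  proof -
    have "w * ((Polynomial.smult t p + q) * (Polynomial.smult t p + q)) =
        Polynomial.smult (t\<^sup>2) (w * (p * p)) + (Polynomial.smult t (w * (p * q)) + Polynomial.smult t (w * (p * q))) + w * (q * q)"
      by (simp add: algebra_simps power2_eq_square)
    then show ?thesis by (simp only: add smult p b_def c_def)
  qed
  also have "\<dots> < 0" using c0 \<open>b \<noteq> 0\<close> by (simp add: t_def)
  finally have "L (w * ((Polynomial.smult t p + q) * (Polynomial.smult t p + q))) < 0" .
  moreover have "degree (Polynomial.smult t p + q) \<le> s"
    using p q by (intro degree_add_le) (auto intro: order.trans[OF degree_smult_le])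
  ultimately show False using w[of "Polynomial.smult t p + q"] by simp
qed

text \<open>One degree is gained over the Cauchy-Schwarz bound: \<open>L (p * p)\<close> is a sum of
  two nonnegative terms, so the x-weighted square vanishes too. Writing q = a + x f, the constant is
  handled with weight 1 and f with weight x.\<close>

lemma null_orthogonal_Suc:
  assumes p: "degree p \<le> s" "L (p * p) = 0" and q: "degree q \<le> Suc s"
  shows "L (p * q) = 0"
proof -
  have 1: "L ([:0, 1:] * (p * p)) = 0"
    using x_nonneg[of p] one_minus_x_nonneg[of p] nonneg_split[of p] p by linarith
  have 2: "L (p * f) = 0" if "degree f \<le> s" for f
    using null_orthogonal[of p 1 f] p that nonneg by simp
  obtain a f where q_eq: "q = pCons a f" by (cases q)
  have f: "degree f \<le> s" using q by (cases "f = 0") (auto simp: q_eq)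
  have "p * q = p * [:a:] + [:0, 1:] * (p * f)"
    by (simp add: q_eq algebra_simps)
  then show ?thesis
    using 2[of "[:a:]"] null_orthogonal[OF p(1) 1 f x_nonneg] by (simp add: add)
qed

text \<open>Gram-Schmidt in inductive form. Degree below \<open>n\<close> is expressed by vanishing
  coefficients, so that \<open>n = 0\<close> means the zero space; \<open>degree q < 0\<close> would
  exclude even the zero polynomial.\<close>

lemma orthogonal_projection:
  assumes "n \<le> Suc s" and pos: "\<And>h. h \<noteq> 0 \<Longrightarrow> degree h < n \<Longrightarrow> L (h * h) > 0"
  shows "\<exists>h. (\<forall>k\<ge>n. coeff h k = 0) \<and> (\<forall>q. (\<forall>k\<ge>n. coeff q k = 0) \<longrightarrow> L ((f - h) * q) = 0)"
  using assms
proof (induction n arbitrary: f)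
  case 0
  have "q = 0" if "\<forall>k. coeff q k = 0" for q :: "real poly"
    using that by (intro poly_eqI) simp
  then show ?case by (intro exI[of _ 0]) force
next
  case (Suc n)
  have IH: "\<exists>h. (\<forall>k\<ge>n. coeff h k = 0) \<and> (\<forall>q. (\<forall>k\<ge>n. coeff q k = 0) \<longrightarrow> L ((f - h) * q) = 0)" for f
    using Suc by auto
  obtain h where h: "\<And>k. k \<ge> n \<Longrightarrow> coeff h k = 0"
      "\<And>q. (\<And>k. k \<ge> n \<Longrightarrow> coeff q k = 0) \<Longrightarrow> L ((f - h) * q) = 0"
    using IH[of f] by blast
  obtain g where g: "\<And>k. k \<ge> n \<Longrightarrow> coeff g k = 0"
      "\<And>q. (\<And>k. k \<ge> n \<Longrightarrow> coeff q k = 0) \<Longrightarrow> L ((monom 1 n - g) * q) = 0"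
    using IH[of "monom 1 n"] by blast
  \<comment> \<open>The monic orthogonal polynomial of degree \<open>n\<close>, obtained from the
    induction hypothesis at x^n; the projection of \<open>f\<close> is then corrected along
    it.\<close>
  define P where "P = monom 1 n - g"
  have Pn: "coeff P n = 1" and Pk: "\<And>k. k > n \<Longrightarrow> coeff P k = 0"
    using g(1) by (auto simp: P_def)
  have "P \<noteq> 0" using Pn by auto
  moreover have "degree P < Suc n" using Pk by (simp add: degree_le le_imp_less_Suc)
  ultimately have PP: "L (P * P) > 0" using Suc.prems by blast
  define c where "c = L ((f - h) * P) / L (P * P)"
  have "L ((f - (h + Polynomial.smult c P)) * q) = 0" if q: "\<And>k. k \<ge> Suc n \<Longrightarrow> coeff q k = 0" for q
  proof -
    define a where "a = coeff q n"
    \<comment> \<open>Removing the leading term along \<open>P\<close> puts \<open>u\<close> in the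
      space covered by the induction hypothesis.\<close>
    define u where "u = q - Polynomial.smult a P"
    have u: "coeff u k = 0" if "k \<ge> n" for k
      using that q Pn Pk by (cases "k = n") (auto simp: u_def a_def)
    have "(f - (h + Polynomial.smult c P)) * q =
        (f - h) * u + Polynomial.smult a ((f - h) * P) - Polynomial.smult c (P * u) - Polynomial.smult (a * c) (P * P)"
      by (simp add: u_def algebra_simps smult_diff_right)
    then have "L ((f - (h + Polynomial.smult c P)) * q) = a * L ((f - h) * P) - a * c * L (P * P)"
      using h(2)[OF u] g(2)[OF u] by (simp add: add diff smult P_def[symmetric])
    also have "\<dots> = 0" using PP by (simp add: c_def)
    finally show ?thesis .
  qed
  moreover have "\<forall>k\<ge>Suc n. coeff (h + Polynomial.smult c P) k = 0" using h(1) Pk by auto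
  ultimately show ?case by blast
qed

text \<open>The bound \<open>2 * s + 1\<close> on the total degree is the range of the given
  moments. It treats two cases at once: for \<open>r = s + 1\<close> this is ordinary orthogonality
  to degrees up to s, while for \<open>r <= s\<close> it includes \<open>q = p\<close>, so that p
  itself is a null vector of the form.\<close>

definition gauss_poly :: "nat \<Rightarrow> real poly \<Rightarrow> bool" where
  "gauss_poly r p \<longleftrightarrow> degree p = r \<and> lead_coeff p = 1 \<and> r \<le> Suc s \<and>
     (\<forall>q. degree q + r \<le> 2 * s + 1 \<longrightarrow> L (p * q) = 0) \<and>
     (\<forall>h. h \<noteq> 0 \<longrightarrow> degree h < r \<longrightarrow> L (h * h) > 0)"

lemma gauss_poly_exists: "\<exists>r p. gauss_poly r p"
proof (cases "\<exists>p. p \<noteq> 0 \<and> degree p \<le> s \<and> L (p * p) = 0")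
  case True
  define Q where "Q r \<longleftrightarrow> (\<exists>p. p \<noteq> 0 \<and> degree p = r \<and> r \<le> s \<and> L (p * p) = 0)" for r
  define r where "r = (LEAST r. Q r)"
  have "\<exists>r. Q r" using True by (auto simp: Q_def)
  then have "Q r" unfolding r_def by (rule LeastI_ex)
  then obtain p where p: "p \<noteq> 0" "degree p = r" "r \<le> s" "L (p * p) = 0"
    by (auto simp: Q_def)
  have pos: "L (h * h) > 0" if "h \<noteq> 0" "degree h < r" for h
  proof -
    have "\<not> Q (degree h)" using that(2) not_less_Least unfolding r_def by blast
    then have "L (h * h) \<noteq> 0" using that p(3) by (auto simp: Q_def)
    moreover have "L (h * h) \<ge> 0" using that p(3) by (intro nonneg) simp
    ultimately show ?thesis by linarith
  qed
  \<comment> \<open>Multiples of p stay null up to degree s. With q = a + x f, the square of p q is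
    a p (p q) + (p f)(x p q); here p and, by induction, p f are null, and their cofactors have
    degree at most s + 1.\<close>
  have null: "L (p * q * (p * q)) = 0 \<and> degree (p * q) \<le> s" if "degree q = n" "n + r \<le> s" for q n
    using that
  proof (induction n arbitrary: q)
    case 0
    then obtain c where "q = [:c:]" by (auto elim: degree_eq_zeroE)
    then show ?case using p by (auto simp: smult intro: order.trans[OF degree_smult_le])
  next
    case (Suc n)
    obtain a f where q: "q = pCons a f" by (cases q)
    then have f: "degree f = n" using Suc.prems by (auto split: if_splits)
    then have f': "L (p * f * (p * f)) = 0" "degree (p * f) \<le> s" using Suc by auto
    have deg: "degree (p * q) \<le> s"
      using Suc.prems p(2) degree_mult_le[of p q] by linarith
    then have "degree ([:0, 1:] * (p * q)) \<le> Suc s"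
      using degree_mult_le[of "[:0, 1:]" "p * q"] by simp
    then have "L ((p * f) * ([:0, 1:] * (p * q))) = 0" by (rule null_orthogonal_Suc[OF f'(2,1)])
    moreover have "L (p * (p * q)) = 0"
      by (rule null_orthogonal_Suc[of p]) (use deg p in auto)
    moreover have "p * q * (p * q) = Polynomial.smult a (p * (p * q)) + (p * f) * ([:0, 1:] * (p * q))"
    proof -
      have q': "q = [:a:] + [:0, 1:] * f" by (simp add: q)
      have "p * q * (p * q) = p * ([:a:] + [:0, 1:] * f) * (p * q)" using q' by simp
      also have "\<dots> = [:a:] * (p * (p * q)) + (p * f) * ([:0, 1:] * (p * q))"
        by (simp only: algebra_simps)
      finally show ?thesis by simp
    qed
    ultimately show ?case using deg by (simp add: add smult)
  qed
  have orth: "L (p * q) = 0" if "degree q + r \<le> 2 * s + 1" for q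
  proof -
    \<comment> \<open>Dividing by x^(s - r) splits q into pieces of degree at most s + 1: the
      remainder is tested against the null polynomial \<open>p\<close>, the quotient against the
      null polynomial \<open>p * m\<close>.\<close>
    define m where "m = monom (1 :: real) (s - r)"
    have m: "m \<noteq> 0" "degree m = s - r" by (auto simp: m_def degree_monom_eq)
    have q_eq: "q = m * (q div m) + q mod m" by simp
    have qm: "degree (q mod m) \<le> Suc s"
      using degree_mod_less'[of m q] m p(3) by (cases "q mod m = 0") auto
    have 1: "L (p * (q mod m)) = 0"
      by (rule null_orthogonal_Suc[of p]) (use p qm in auto)
    have qd: "degree (q div m) \<le> Suc s"
    proof (cases "q div m = 0")
      case False
      have "degree (m * (q div m)) = degree (q - q mod m)" by (simp add: minus_mod_eq_mult_div)
      also have "\<dots> \<le> max (degree q) (s - r)"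
        using degree_mod_less'[of m q] m
        by (cases "q mod m = 0") (auto intro!: order.trans[OF degree_diff_le_max])
      finally have "s - r + degree (q div m) \<le> max (degree q) (s - r)"
        using False m by (simp add: degree_mult_eq)
      then show ?thesis using that p(3) by auto
    qed simp
    have 2: "L ((p * m) * (q div m)) = 0"
      by (rule null_orthogonal_Suc[of "p * m"]) (use null[of m "s - r"] m p(3) qd in auto)
    have "p * q = p * m * (q div m) + p * (q mod m)"
      using arg_cong[OF q_eq, of "(*) p"] by (simp only: algebra_simps)
    then show ?thesis using 1 2 by (simp add: add)
  qed
  define p' where "p' = Polynomial.smult (inverse (lead_coeff p)) p"
  have "gauss_poly r p'"
    using p pos orth by (auto simp: gauss_poly_def p'_def smult)
  then show ?thesis by blast
next
  case False
  then have pos: "L (h * h) > 0" if "h \<noteq> 0" "degree h < Suc s" for h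
    using nonneg[of h] that by (force simp: less_Suc_eq_le order_le_less)
  \<comment> \<open>For degree s + 1 the admissible test polynomials have degree at most s, exactly
    the space onto which x^(s + 1) is projected.\<close>
  obtain h where h: "\<And>k. k \<ge> Suc s \<Longrightarrow> coeff h k = 0"
      "\<And>q. (\<And>k. k \<ge> Suc s \<Longrightarrow> coeff q k = 0) \<Longrightarrow> L ((monom 1 (Suc s) - h) * q) = 0"
    using orthogonal_projection[of "Suc s" "monom 1 (Suc s)"] pos by blast
  define P where "P = monom 1 (Suc s) - h"
  have "coeff P (Suc s) = 1" "\<And>k. k > Suc s \<Longrightarrow> coeff P k = 0"
    using h(1) by (auto simp: P_def)
  then have P: "degree P = Suc s" "lead_coeff P = 1"
    by (metis (no_types) degree_le le_antisym le_degree less_or_eq_imp_le linorder_not_le zero_neq_one)+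
  have "L (P * q) = 0" if "degree q \<le> s" for q
    unfolding P_def using that by (intro h(2) coeff_eq_0) auto
  then have "gauss_poly (Suc s) P"
    using P pos by (auto simp: gauss_poly_def)
  then show ?thesis by blast
qed


section \<open>Roots of the orthogonal polynomial: real, simple and in the unit interval\<close>

lemma gauss_poly_pos: "gauss_poly r p \<Longrightarrow> h \<noteq> 0 \<Longrightarrow> degree h < r \<Longrightarrow> L (h * h) > 0"
  by (simp add: gauss_poly_def)

lemma gauss_poly_orthogonal: "gauss_poly r p \<Longrightarrow> degree q + r \<le> 2 * s + 1 \<Longrightarrow> L (p * q) = 0"
  by (simp add: gauss_poly_def)

lemma gauss_polyD:
  assumes "gauss_poly r p"
  shows "degree p = r" "lead_coeff p = 1" "r \<le> Suc s" "p \<noteq> 0"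
  using assms by (auto simp: gauss_poly_def)

text \<open>With p = (x - a) q, orthogonality to q exhibits \<open>a\<close> as the mean of x for
  the weight q^2. Nonnegativity of the functional against x q^2 and (1 - x) q^2 then bounds this
  mean.\<close>

lemma gauss_poly_root_bounds:
  assumes g: "gauss_poly r p" and a: "poly p a = 0"
  shows "a \<in> {0..1}"
proof -
  obtain q where q: "p = [:-a, 1:] * q" using a by (auto simp: poly_eq_0_iff_dvd)
  have "q \<noteq> 0" using gauss_polyD[OF g] q by auto
  then have deg: "Suc (degree q) = r" using gauss_polyD(1)[OF g] unfolding q by (subst (asm) degree_mult_eq) auto
  have pos: "L (q * q) > 0" using gauss_poly_pos[OF g \<open>q \<noteq> 0\<close>] deg by simp
  have "L (p * q) = 0" using gauss_poly_orthogonal[OF g] deg gauss_polyD(3)[OF g] by simp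
  moreover have "p * q = [:0, 1:] * (q * q) - Polynomial.smult a (q * q)"
    by (simp add: q algebra_simps)
  ultimately have X: "L ([:0, 1:] * (q * q)) = a * L (q * q)" by (simp add: diff smult)
  have "degree q \<le> s" using deg gauss_polyD(3)[OF g] by simp
  then have "a * L (q * q) \<ge> 0" "(1 - a) * L (q * q) \<ge> 0"
    using x_nonneg[of q] one_minus_x_nonneg[of q] nonneg_split[of q] X by (simp_all add: algebra_simps)
  then show ?thesis using pos by (simp add: zero_le_mult_iff)
qed

text \<open>At a double root \<open>a\<close>, write \<open>p = (x - a)\<^sup>2 u\<close>; then \<open>p u = ((x - a) u)\<^sup>2\<close> is positive under \<open>L\<close>.\<close>

lemma gauss_poly_simple_root:
  assumes g: "gauss_poly r p" and a: "poly p a = 0"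
  shows "poly (pderiv p) a \<noteq> 0"
proof
  assume d: "poly (pderiv p) a = 0"
  obtain q where q: "p = [:-a, 1:] * q" using a by (auto simp: poly_eq_0_iff_dvd)
  have "poly q a = 0" using d unfolding q pderiv_mult by (simp add: pderiv_pCons)
  then obtain u where u: "q = [:-a, 1:] * u" by (auto simp: poly_eq_0_iff_dvd)
  have nz: "q \<noteq> 0" "u \<noteq> 0" using gauss_polyD(4)[OF g] q u by auto
  then have dq: "Suc (degree q) = r" using gauss_polyD(1)[OF g] unfolding q by (subst (asm) degree_mult_eq) auto
  have "Suc (degree u) = degree q" using nz unfolding u by (subst degree_mult_eq) auto
  then have "L (p * u) = 0"
    using gauss_poly_orthogonal[OF g] dq gauss_polyD(3)[OF g] by simp
  moreover have "p * u = q * q" by (subst q, subst (2) u) (simp only: ac_simps)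
  moreover have "L (q * q) > 0" using gauss_poly_pos[OF g nz(1)] dq by simp
  ultimately show False by simp
qed

text \<open>The quadratic is (x - u)^2 + v^2, the real factor of a conjugate pair u + iv, u - iv.
  Testing p against its cofactor q gives a sum of two strictly positive terms, the square of (x - u)
  q and v^2 times that of q.\<close>

lemma gauss_poly_no_quadratic_factor:
  assumes g: "gauss_poly r p" and v: "v \<noteq> 0"
  shows "\<not> [:u\<^sup>2 + v\<^sup>2, - 2 * u, 1:] dvd p"
proof
  assume "[:u\<^sup>2 + v\<^sup>2, - 2 * u, 1:] dvd p"
  then obtain q where q: "p = [:u\<^sup>2 + v\<^sup>2, - 2 * u, 1:] * q" by (auto elim: dvdE)
  have nz: "q \<noteq> 0" using gauss_polyD(4)[OF g] q by auto
  then have deg: "Suc (Suc (degree q)) = r"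
    using gauss_polyD(1)[OF g] unfolding q by (subst (asm) degree_mult_eq) auto
  have "L (p * q) = 0"
    using gauss_poly_orthogonal[OF g] deg gauss_polyD(3)[OF g] by simp
  moreover have "p * q = ([:-u, 1:] * q) * ([:-u, 1:] * q) + Polynomial.smult (v\<^sup>2) (q * q)"
  proof -
    have "[:u\<^sup>2 + v\<^sup>2, - 2 * u, 1:] = [:-u, 1:] * [:-u, 1:] + [:v\<^sup>2:]"
      by (simp add: power2_eq_square)
    then have "p * q = ([:-u, 1:] * [:-u, 1:] + [:v\<^sup>2:]) * q * q" by (simp only: q)
    also have "\<dots> = ([:-u, 1:] * q) * ([:-u, 1:] * q) + [:v\<^sup>2:] * (q * q)"
      by (simp only: algebra_simps)
    finally show ?thesis by simp
  qed
  moreover have "L (([:-u, 1:] * q) * ([:-u, 1:] * q)) > 0"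
    using nz deg by (intro gauss_poly_pos[OF g]) (auto simp del: mult_pCons_left simp: degree_mult_eq)
  moreover have "L (q * q) > 0" using gauss_poly_pos[OF g nz] deg by simp
  moreover have "v\<^sup>2 > 0" using v by simp
  ultimately show False
    by (metis add add_pos_pos less_irrefl mult_pos_pos smult)
qed

text \<open>Modulo the real quadratic with roots z and its conjugate, p leaves a real remainder of
  degree at most 1. It vanishes at z, and a nonreal z forces both of its coefficients to be
  0.\<close>

lemma gauss_poly_complex_root_real:
  assumes g: "gauss_poly r p" and z: "poly (map_poly complex_of_real p) z = 0"
  shows "Im z = 0"
proof (rule ccontr)
  assume v: "Im z \<noteq> 0"
  let ?w = "[:(Re z)\<^sup>2 + (Im z)\<^sup>2, - 2 * Re z, 1:]"
  define m where "m = p mod ?w"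
  have "m = 0 \<or> degree m < 2"
    using degree_mod_less[of ?w p] by (auto simp: m_def)
  then have "degree m \<le> 1" by auto
  then obtain b c where m: "m = [:b, c:]"
    by (metis One_nat_def degree_eq_zeroE degree_pCons_eq_if le_SucE le_zero_eq pCons_cases
        nat.inject pCons_eq_0_iff)
  have w0: "poly (map_poly complex_of_real ?w) z = 0"
    by (simp add: map_poly_pCons complex_eq_iff power2_eq_square algebra_simps)
  have "map_poly complex_of_real p =
      map_poly complex_of_real (p div ?w) * map_poly complex_of_real ?w + map_poly complex_of_real m"
    by (subst div_mult_mod_eq[of p ?w, symmetric], unfold m_def)
      (rule poly_eqI, simp only: coeff_map_poly of_real_0 coeff_add coeff_mult of_real_add of_real_sum of_real_mult)
  then have "poly (map_poly complex_of_real m) z = 0" using z w0 by simp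
  then have "b = 0" "c = 0" using v by (auto simp: m map_poly_pCons complex_eq_iff)
  then have "m = 0" by (simp add: m)
  then have "?w dvd p" by (simp only: m_def dvd_eq_mod_eq_0)
  then show False using gauss_poly_no_quadratic_factor[OF g v] by blast
qed

text \<open>Over the complex numbers p splits; as all roots are real and simple, it is a product of
  distinct linear factors, whose number is the degree.\<close>

lemma gauss_poly_card_roots:
  assumes g: "gauss_poly r p"
  shows "card {x. poly p x = 0} = r"
proof -
  let ?P = "map_poly complex_of_real p"
  have ev: "poly (map_poly complex_of_real f) (of_real x) = of_real (poly f x)" for f x
    by (induction f) (auto simp: map_poly_pCons)
  have roots: "{z. poly ?P z = 0} = of_real ` {x. poly p x = 0}"
  proof (intro equalityI subsetI)
    fix z assume "z \<in> {z. poly ?P z = 0}"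
    then have z: "poly ?P z = 0" by simp
    then have "z = of_real (Re z)" using gauss_poly_complex_root_real[OF g z] by (simp add: complex_eq_iff)
    then show "z \<in> of_real ` {x. poly p x = 0}" using z ev[of p "Re z"] by auto
  qed (auto simp: ev)
  have "pderiv ?P = map_poly complex_of_real (pderiv p)"
    by (intro poly_eqI) (simp add: coeff_pderiv coeff_map_poly)
  then have "rsquarefree ?P"
    unfolding rsquarefree_roots
  proof (intro allI notI, elim conjE)
    fix z assume z: "poly ?P z = 0" "poly (pderiv ?P) z = 0"
    then have "z \<in> of_real ` {x. poly p x = 0}" using roots by blast
    then obtain x where "z = of_real x" "poly p x = 0" by blast
    then show False
      using z(2) gauss_poly_simple_root[OF g] \<open>pderiv ?P = _\<close> by (simp add: ev)
  qed
  then have "Polynomial.smult (lead_coeff ?P) (\<Prod>z|poly ?P z = 0. [:-z, 1:]) = ?P"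
    by (rule complex_poly_decompose_rsquarefree)
  moreover have deg: "degree ?P = r" using gauss_polyD(1)[OF g] by (simp add: degree_map_poly)
  moreover have "lead_coeff ?P = 1"
    using gauss_polyD(1,2)[OF g] deg by (simp add: coeff_map_poly)
  ultimately have "degree (\<Prod>z|poly ?P z = 0. [:-z, 1:]) = r" by simp
  then have "card {z. poly ?P z = 0} = r" by (simp add: degree_prod_eq_sum_degree)
  then show ?thesis unfolding roots by (subst (asm) card_image) (auto simp: inj_on_def)
qed

end

section \<open>Lagrange interpolation and Gauss quadrature\<close>

definition lagrange_poly :: "real set \<Rightarrow> real \<Rightarrow> real poly" where
  "lagrange_poly R x = Polynomial.smult (inverse (\<Prod>z\<in>R - {x}. x - z)) (\<Prod>z\<in>R - {x}. [:-z, 1:])"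

lemma degree_lagrange_poly:
  assumes "finite R" "x \<in> R" shows "degree (lagrange_poly R x) < card R"
proof -
  have "degree (lagrange_poly R x) \<le> card (R - {x})"
    unfolding lagrange_poly_def
    by (intro order.trans[OF degree_smult_le]) (simp add: degree_prod_eq_sum_degree)
  also have "\<dots> < card R" using assms by (intro psubset_card_mono) auto
  finally show ?thesis .
qed

lemma poly_lagrange_poly:
  assumes "finite R" "x \<in> R" "z \<in> R"
  shows "poly (lagrange_poly R x) z = (if z = x then 1 else 0)"
  using assms by (auto simp: lagrange_poly_def poly_prod)

lemma lagrange_interpolation:
  assumes R: "finite R" and f: "f = 0 \<or> degree f < card R"
  shows "f = (\<Sum>x\<in>R. Polynomial.smult (poly f x) (lagrange_poly R x))" (is "f = ?g")
proof (cases "R = {}")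
  case False
  then have pos: "card R > 0" using R by (simp add: card_gt_0_iff)
  have "degree ?g \<le> card R - 1"
    using degree_lagrange_poly[OF R]
    by (intro degree_sum_le R order.trans[OF degree_smult_le]) fastforce
  then have "degree ?g < card R" using pos by linarith
  moreover have "poly f z = poly ?g z" if "z \<in> R" for z
    using R that
    by (simp add: poly_sum poly_lagrange_poly if_distrib[of "(*) _"] cong: if_cong)
  moreover have "degree f < card R" using f pos by auto
  ultimately show ?thesis using poly_eqI_degree[of R f ?g] by blast
qed (use f in auto)

context hausdorff_functional
begin

lemma gauss_poly_finite_roots: "gauss_poly r p \<Longrightarrow> finite {x. poly p x = 0}"
  by (rule poly_roots_finite) (rule gauss_polyD)

text \<open>Division by p: the multiple of p is annihilated by orthogonality, and the remainder, of
  degree below r, is recovered from its values at the r roots, where it agrees with f.\<close>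

lemma gauss_quadrature:
  assumes g: "gauss_poly r p" and f: "degree f \<le> 2 * s + 1"
  defines "R \<equiv> {x. poly p x = 0}"
  shows "L f = (\<Sum>x\<in>R. L (lagrange_poly R x) * poly f x)"
proof -
  note p = gauss_polyD[OF g]
  have R: "finite R" "card R = r"
    using gauss_poly_finite_roots[OF g] gauss_poly_card_roots[OF g] by (simp_all add: R_def)
  have mod: "f mod p = 0 \<or> degree (f mod p) < card R"
    using degree_mod_less[OF p(4), of f] p(1) R by auto
  have "L (p * (f div p)) = 0"
  proof (cases "f div p = 0")
    case False
    have "degree (p * (f div p)) = degree (f - f mod p)" by (simp add: minus_mod_eq_mult_div)
    also have "\<dots> \<le> max (degree f) (degree (f mod p))" by (rule degree_diff_le_max)
    also have "\<dots> \<le> 2 * s + 1" using mod f R p(3) by auto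
    finally show ?thesis
      using gauss_poly_orthogonal[OF g] False p by (simp add: degree_mult_eq add.commute)
  qed simp
  moreover have "L f = L (p * (f div p)) + L (f mod p)" by (simp flip: add)
  ultimately have "L f = L (f mod p)" by simp
  also have "\<dots> = (\<Sum>x\<in>R. poly (f mod p) x * L (lagrange_poly R x))"
    by (subst lagrange_interpolation[OF R(1) mod]) (simp only: sum smult)
  also have "\<dots> = (\<Sum>x\<in>R. L (lagrange_poly R x) * poly f x)"
  proof (intro sum.cong refl)
    fix x assume "x \<in> R"
    then have "poly p x = 0" by (simp add: R_def)
    then have "poly (p * (f div p) + f mod p) x = poly (f mod p) x"
      by (simp only: poly_add poly_mult mult_zero_left add_0)
    then show "poly (f mod p) x * L (lagrange_poly R x) = L (lagrange_poly R x) * poly f x" by simp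
  qed
  finally show ?thesis .
qed

lemma gauss_weight_pos:
  assumes g: "gauss_poly r p"
  defines "R \<equiv> {x. poly p x = 0}"
  assumes x: "x \<in> R"
  shows "L (lagrange_poly R x) > 0"
proof -
  have R: "finite R" "card R = r"
    using gauss_poly_finite_roots[OF g] gauss_poly_card_roots[OF g] by (simp_all add: R_def)
  let ?l = "lagrange_poly R x"
  have deg: "degree ?l < r" using degree_lagrange_poly[OF R(1) x] R(2) by simp
  \<comment> \<open>The square has degree at most 2 (r - 1), and \<open>r <= s + 1\<close> keeps it
    within the range of exactness.\<close>
  have "degree (?l * ?l) \<le> 2 * s + 1"
    using degree_mult_le[of ?l ?l] deg gauss_polyD(3)[OF g] by linarith
  then have "L (?l * ?l) = (\<Sum>z\<in>R. L (lagrange_poly R z) * poly (?l * ?l) z)"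
    unfolding R_def by (rule gauss_quadrature[OF g])
  also have "\<dots> = (\<Sum>z\<in>R. if z = x then L ?l else 0)"
    using R(1) x by (intro sum.cong) (auto simp: poly_lagrange_poly)
  also have "\<dots> = L ?l" using R(1) x by simp
  finally have "L ?l = L (?l * ?l)" ..
  moreover have "?l \<noteq> 0" using poly_lagrange_poly[OF R(1) x x] by auto
  ultimately show ?thesis using gauss_poly_pos[OF g] deg by simp
qed

text \<open>The difference of two monic candidates has degree below r and is orthogonal to itself,
  so positivity makes it zero.\<close>

lemma gauss_poly_unique:
  assumes g: "gauss_poly r p" and q: "degree q = r" "lead_coeff q = 1"
    and orth: "\<And>f. degree f < r \<Longrightarrow> L (q * f) = 0"
  shows "q = p"
proof (rule ccontr)
  assume "q \<noteq> p"
  \<comment> \<open>For \<open>r = 0\<close> both polynomials are 1; this is settled first because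
    the zero polynomial has degree 0, which is not below 0.\<close>
  have "r \<noteq> 0"
  proof
    assume "r = 0"
    then obtain a b where "q = [:a:]" "p = [:b:]"
      using q(1) gauss_polyD(1)[OF g] by (auto elim!: degree_eq_zeroE)
    then show False using \<open>q \<noteq> p\<close> q(2) gauss_polyD(2)[OF g] by auto
  qed
  have "degree (q - p) \<le> r" using q gauss_polyD(1)[OF g] by (intro degree_diff_le) auto
  moreover have "coeff (q - p) r = 0" using q gauss_polyD(1,2)[OF g] by auto
  ultimately have deg: "degree (q - p) < r"
    using \<open>r \<noteq> 0\<close> by (metis degree_0 leading_coeff_0_iff le_neq_implies_less not_gr_zero)
  have "L ((q - p) * (q - p)) = L (q * (q - p)) - L (p * (q - p))"
    by (simp add: left_diff_distrib diff)
  also have "\<dots> = 0"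
    using orth[OF deg] gauss_poly_orthogonal[OF g, of "q - p"] deg gauss_polyD(3)[OF g] by simp
  finally show False using gauss_poly_pos[OF g _ deg] \<open>q \<noteq> p\<close> by simp
qed

text \<open>The node polynomial q vanishes on S, so the quadrature gives
  \<open>L (q * f) = 0\<close>. With fewer than r nodes, f = q would contradict positivity; with r
  nodes, q is the orthogonal polynomial. Allowing \<open>card S <= r\<close> later yields the lower
  bound on the cp-rank.\<close>

lemma quadrature_unique:
  assumes g: "gauss_poly r p" and S: "finite S" "card S \<le> r"
    and quad: "\<And>f. degree f \<le> 2 * s + 1 \<Longrightarrow> L f = (\<Sum>x\<in>S. v x * poly f x)"
  shows "S = {x. poly p x = 0}" "x \<in> S \<Longrightarrow> v x = L (lagrange_poly S x)"
proof -
  define q where "q = (\<Prod>x\<in>S. [:-x, 1:])"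
  have deg: "degree q = card S" by (simp add: q_def degree_prod_eq_sum_degree)
  have lead: "lead_coeff q = 1" by (simp add: q_def lead_coeff_prod)
  have root: "poly q x = 0 \<longleftrightarrow> x \<in> S" for x using S(1) by (auto simp: q_def poly_prod)
  have r: "r \<le> Suc s" by (rule gauss_polyD(3)[OF g])
  have orth: "L (q * f) = 0" if "degree f < r" for f
  proof -
    have "degree (q * f) \<le> 2 * s + 1" using degree_mult_le[of q f] deg S(2) r that by linarith
    then show ?thesis using root by (simp add: quad)
  qed
  have "card S = r"
  proof (rule ccontr)
    assume "card S \<noteq> r"
    then have "degree q < r" using S(2) deg by simp
    moreover have "q \<noteq> 0" using lead by auto
    ultimately show False using orth[of q] gauss_poly_pos[OF g, of q] by simp
  qed
  then have "q = p" using deg lead orth by (intro gauss_poly_unique[OF g]) auto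
  then show "S = {x. poly p x = 0}" using root by auto
  show "v x = L (lagrange_poly S x)" if "x \<in> S"
  proof -
    have "L (lagrange_poly S x) = (\<Sum>z\<in>S. v z * poly (lagrange_poly S x) z)"
      using degree_lagrange_poly[OF S(1) that] S(2) r by (intro quad) simp
    also have "\<dots> = (\<Sum>z\<in>S. if z = x then v x else 0)"
      using S(1) that by (intro sum.cong) (auto simp: poly_lagrange_poly)
    finally show ?thesis using S(1) that by simp
  qed
qed

end

section \<open>Rank of a matrix from leading columns\<close>

text \<open>The first r columns are independent and generate the others, so they form a maximal
  independent set of columns.\<close>

lemma mat_rank_eqI:
  assumes r: "r \<le> s + 1"
    and indep: "\<And>c j. (\<And>i. i \<le> s \<Longrightarrow> (\<Sum>j<r. M i j * c j) = 0) \<Longrightarrow> j < r \<Longrightarrow> c j = 0"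
    and gen: "\<And>j. j \<le> s \<Longrightarrow> \<exists>c. \<forall>i\<le>s. M i j = (\<Sum>k<r. M i k * c k)"
  shows "mat_rank s M = r"
proof -
  interpret vec_space "TYPE(real)" "s + 1" .
  define A where "A = Matrix.mat (s + 1) (s + 1) (\<lambda>(i, j). M i j)"
  define B where "B = Matrix.mat (s + 1) r (\<lambda>(i, j). M i j)"
  have A: "A \<in> carrier_mat (s + 1) (s + 1)" and B: "B \<in> carrier_mat (s + 1) r"
    by (simp_all add: A_def B_def)
  have Bv: "(B *\<^sub>v v) $ i = (\<Sum>j<r. M i j * v $ j)" if "v \<in> carrier_vec r" "i \<le> s" for v i
    using that by (auto simp: B_def scalar_prod_def atLeast0LessThan intro!: sum.cong)
  have colB: "col B j = col A j" if "j < r" for j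
    using that r by (intro eq_vecI) (simp_all add: A_def B_def)
  have sub: "set (cols B) \<subseteq> set (cols A)"
  proof
    fix x assume "x \<in> set (cols B)"
    then obtain j where "j < r" "x = col B j" by (auto simp: cols_def B_def)
    then have "x = cols A ! j" "j < length (cols A)" using r colB by (simp_all add: A_def)
    then show "x \<in> set (cols A)" by (metis nth_mem)
  qed
  \<comment> \<open>Rank is counted on the set of columns, so repetitions must be excluded. Equal
    columns i and j would give the dependency with coefficients 1 and -1.\<close>
  have dist: "distinct (cols B)"
    unfolding distinct_conv_nth
  proof (intro allI impI notI)
    fix i j assume "i < length (cols B)" "j < length (cols B)" "i \<noteq> j" and eq: "cols B ! i = cols B ! j"
    then have ij: "i < r" "j < r" "i \<noteq> j" by (simp_all add: B_def)
    define c where "c k = (if k = i then 1 else if k = j then -1 else 0 :: real)" for k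
    have "(\<Sum>k<r. M l k * c k) = 0" if l: "l \<le> s" for l
    proof -
      have "col B i $ l = col B j $ l" using eq ij by (simp add: B_def)
      then have "M l i = M l j" using ij l by (simp add: B_def)
      moreover have "(\<Sum>k<r. M l k * c k) = (\<Sum>k\<in>{i, j}. M l k * c k)"
        using ij by (intro sum.mono_neutral_right) (auto simp: c_def)
      moreover have "\<dots> = M l i - M l j" using ij by (simp add: c_def)
      ultimately show ?thesis by linarith
    qed
    from indep[OF this ij(1)] show False by (simp add: c_def)
  qed
  have li: "lin_indpt (set (cols B))"
  proof
    assume "lin_dep (set (cols B))"
    then obtain v where v: "v \<in> carrier_vec r" "v \<noteq> 0\<^sub>v r" "B *\<^sub>v v = 0\<^sub>v (s + 1)"
      using lin_depE[OF B _ dist] by metis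
    have "(\<Sum>j<r. M i j * v $ j) = 0" if "i \<le> s" for i
      using Bv[OF v(1) that] v(3) that by simp
    then have "v $ j = 0" if "j < r" for j using indep[of "\<lambda>j. v $ j"] that by blast
    then have "v = 0\<^sub>v r" using v(1) by (intro eq_vecI) auto
    then show False using v(2) by simp
  qed
  have carr: "set (cols B) \<subseteq> carrier_vec (s + 1)" using cols_dim[of B] B by simp
  have span: "col A j \<in> span (set (cols B))" if j: "j \<le> s" for j
  proof -
    obtain c where c: "\<And>i. i \<le> s \<Longrightarrow> M i j = (\<Sum>k<r. M i k * c k)" using gen[OF j] by blast
    have "col A j = B *\<^sub>v Matrix.vec r c"
    proof (rule eq_vecI)
      show "dim_vec (col A j) = dim_vec (B *\<^sub>v Matrix.vec r c)" by (simp add: A_def B_def)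
      fix i assume "i < dim_vec (B *\<^sub>v Matrix.vec r c)"
      then have i: "i \<le> s" by (simp add: B_def)
      then show "col A j $ i = (B *\<^sub>v Matrix.vec r c) $ i"
        using j by (subst Bv) (simp_all add: A_def c)
    qed
    also have "\<dots> = lincomb (\<lambda>a. Matrix.vec r c $ find_first a (cols B)) (set (cols B))"
      by (rule lincomb_eq_mat_mult[OF B _ dist, symmetric]) simp
    finally show ?thesis by (rule in_spanI) auto
  qed
  have "T = set (cols B)"
    if T: "set (cols B) \<subseteq> T" "T \<subseteq> set (cols A)" "lin_indpt T" for T
  proof (rule ccontr)
    assume "T \<noteq> set (cols B)"
    then obtain x where x: "x \<in> T" "x \<notin> set (cols B)" using T(1) by blast
    then have "x \<in> set (cols A)" using T(2) by blast
    then obtain j where j: "j < length (cols A)" "x = cols A ! j" by (metis in_set_conv_nth)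
    then have "j \<le> s" "x = col A j" by (simp_all add: A_def)
    moreover from this have "x \<in> carrier_vec (s + 1)" by (simp add: A_def)
    ultimately have "lin_dep (set (cols B) \<union> {x})"
      using lin_dep_iff_in_span[OF carr li _ x(2)] span[of j] by simp
    moreover have "set (cols B) \<union> {x} \<subseteq> T" using T(1) x(1) by simp
    ultimately show False using T(3) supset_ld_is_ld by blast
  qed
  then have "maximal (set (cols B)) (\<lambda>T. T \<subseteq> set (cols A) \<and> lin_indpt T)"
    unfolding maximal_def using sub li by simp
  then have "rank A = card (set (cols B))" by (rule rank_card_indpt[OF A])
  also have "\<dots> = r" using distinct_card[OF dist] by (simp add: B_def)
  finally show ?thesis by (simp add: mat_rank_def A_def)
qed

section \<open>Hankel matrices and the truncated moment problem\<close>

text \<open>The truncated Riesz functional. Coefficients above \<open>d\<close> are ignored, which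
  makes it linear on all polynomials.\<close>

definition riesz :: "(nat \<Rightarrow> real) \<Rightarrow> nat \<Rightarrow> real poly \<Rightarrow> real" where
  "riesz y d p = (\<Sum>k\<le>d. coeff p k * y k)"

lemma riesz_add: "riesz y d (p + q) = riesz y d p + riesz y d q"
  by (simp add: riesz_def distrib_right sum.distrib)

lemma riesz_smult: "riesz y d (Polynomial.smult c p) = c * riesz y d p"
  by (simp add: riesz_def sum_distrib_left mult.assoc)

lemma riesz_diff: "riesz y d (p - q) = riesz y d p - riesz y d q"
  by (simp add: riesz_def left_diff_distrib sum_subtractf)

lemma riesz_sum: "riesz y d (\<Sum>i\<in>I. f i) = (\<Sum>i\<in>I. riesz y d (f i))"
  by (induction I rule: infinite_finite_induct) (simp_all add: riesz_add, simp_all add: riesz_def)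

lemma riesz_monom: "k \<le> d \<Longrightarrow> riesz y d (monom c k) = c * y k"
  by (simp add: riesz_def if_distrib[of "\<lambda>x. x * _"] cong: if_cong)

lemma poly_eq_sum_monom:
  assumes "\<And>k. k \<ge> n \<Longrightarrow> coeff p k = 0"
  shows "p = (\<Sum>k<n. monom (coeff p k) k)"
  using assms by (intro poly_eqI) (auto simp: coeff_sum not_less)

text \<open>The Hankel form as a bilinear form on coefficients. The shift \<open>e\<close> gives
  \<open>H1\<close> for 0 and \<open>H3\<close> for 1; the bound on \<open>i + j + e\<close> ensures
  that no term is truncated.\<close>

lemma riesz_mult:
  assumes p: "\<And>k. k \<ge> n \<Longrightarrow> coeff p k = 0" and q: "\<And>k. k \<ge> m \<Longrightarrow> coeff q k = 0"
    and deg: "\<And>i j. i < n \<Longrightarrow> j < m \<Longrightarrow> i + j + e \<le> d"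
  shows "riesz y d (monom 1 e * (p * q)) = (\<Sum>i<n. \<Sum>j<m. coeff p i * coeff q j * y (i + j + e))"
proof -
  have "monom 1 e * (p * q) =
      monom 1 e * ((\<Sum>i<n. monom (coeff p i) i) * (\<Sum>j<m. monom (coeff q j) j))"
    using poly_eq_sum_monom[of n p] poly_eq_sum_monom[of m q] p q by simp
  also have "\<dots> = (\<Sum>i<n. \<Sum>j<m. monom (coeff p i * coeff q j) (i + j + e))"
    unfolding sum_product by (simp add: sum_distrib_left mult_monom add.commute)
  finally show ?thesis using deg by (simp add: riesz_sum riesz_monom)
qed

lemma hausdorff_functional_riesz:
  assumes H3: "psd s (H3 y)" and H4: "psd s (H4 y)"
  shows "hausdorff_functional (riesz y (2 * s + 1)) s"
proof
  fix p q :: "real poly" and c :: real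
  let ?L = "riesz y (2 * s + 1)"
  show "?L (p + q) = ?L p + ?L q" by (rule riesz_add)
  show "?L (Polynomial.smult c p) = c * ?L p" by (rule riesz_smult)
  assume "degree p \<le> s"
  then have p: "\<And>k. k \<ge> Suc s \<Longrightarrow> coeff p k = 0" by (intro coeff_eq_0) simp
  have e: "?L (monom 1 e * (p * p)) = (\<Sum>i\<le>s. \<Sum>j\<le>s. coeff p i * coeff p j * y (i + j + e))"
    if "e \<le> 1" for e
    using riesz_mult[of "Suc s" p "Suc s" p e "2 * s + 1" y, OF p p] that by (simp add: lessThan_Suc_atMost)
  have X: "[:0, 1:] = monom (1 :: real) 1" by (simp add: monom_altdef)
  show "?L ([:0, 1:] * (p * p)) \<ge> 0"
    unfolding X e[OF order_refl] using H3[unfolded psd_def, rule_format, of "coeff p"]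
    by (simp add: H3_def mult_ac)
  have "[:1, -1:] * (p * p) = monom 1 0 * (p * p) - monom 1 1 * (p * p)"
  proof -
    have "[:1, -1:] = monom (1 :: real) 0 - monom 1 1" by (simp add: monom_altdef one_pCons)
    then show ?thesis by (simp only: left_diff_distrib)
  qed
  then have "?L ([:1, -1:] * (p * p)) = (\<Sum>i\<le>s. \<Sum>j\<le>s. coeff p i * H4 y i j * coeff p j)"
    by (simp only: riesz_diff e le0 order_refl)
      (simp add: H4_def sum_subtractf[symmetric] algebra_simps)
  then show "?L ([:1, -1:] * (p * p)) \<ge> 0"
    using H4[unfolded psd_def, rule_format, of "coeff p"] by simp
qed

text \<open>A dependency among the first r columns is a polynomial h of degree below r with zero
  form value at h * h, hence h = 0. The other columns follow by reducing monomials modulo p.\<close>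

lemma mat_rank_gauss_poly:
  assumes H: "hausdorff_functional (riesz y (2 * s + 1)) s"
    and g: "hausdorff_functional.gauss_poly (riesz y (2 * s + 1)) s r p"
  shows "mat_rank s (H1 y) = r"
proof (rule mat_rank_eqI)
  interpret hausdorff_functional "riesz y (2 * s + 1)" s by (rule H)
  note p = gauss_polyD[OF g]
  show "r \<le> s + 1" using p by simp
  fix j :: nat
  {
    fix c :: "nat \<Rightarrow> real"
    assume c: "\<And>i. i \<le> s \<Longrightarrow> (\<Sum>j<r. H1 y i j * c j) = 0" and j: "j < r"
    define h where "h = (\<Sum>j<r. monom (c j) j)"
    have coeff_h: "coeff h k = (if k < r then c k else 0)" for k
      by (simp add: h_def coeff_sum)
    have "degree h < r"
      using j by (intro degree_lessI) (auto simp: coeff_h)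
    moreover have "riesz y (2 * s + 1) (h * h) = 0"
    proof -
      have "riesz y (2 * s + 1) (monom 1 0 * (h * h)) = (\<Sum>i<r. \<Sum>j<r. c i * c j * y (i + j))"
        using p(3) by (subst riesz_mult[of r _ r]) (auto simp: coeff_h)
      also have "\<dots> = (\<Sum>i<r. c i * (\<Sum>j<r. H1 y i j * c j))"
        by (simp add: sum_distrib_left H1_def mult_ac)
      also have "\<dots> = 0" using c p(3) by (intro sum.neutral) auto
      finally show ?thesis by simp
    qed
    ultimately have "h = 0" using gauss_poly_pos[OF g, of h] by auto
    then show "c j = 0" using coeff_h[of j] j by simp
  }
  assume j: "j \<le> s"
  \<comment> \<open>Its coefficients express column j through the first r columns: x^j - h is a
    multiple of p, and orthogonality kills that multiple times x^i.\<close>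
  define h where "h = monom 1 j mod p"
  define q where "q = monom 1 j div p"
  have h0: "coeff h k = 0" if "k \<ge> r" for k
    using degree_mod_less[OF p(4), of "monom 1 j"] that p(1) by (auto simp: h_def intro: coeff_eq_0)
  have eq: "monom 1 j - h = p * q" by (simp add: h_def q_def minus_mod_eq_mult_div)
  have "H1 y i j = (\<Sum>k<r. H1 y i k * coeff h k)" if i: "i \<le> s" for i
  proof -
    have "riesz y (2 * s + 1) (monom 1 i * (p * q)) = 0"
    proof (cases "q = 0")
      case False
      have hj: "degree h \<le> j"
        unfolding h_def using degree_mod_less[OF p(4), of "monom 1 j"] p(1)
        by (cases "r \<le> j") (auto simp: mod_poly_less degree_monom_eq)
      have "r + degree q = degree (p * q)" using False p by (simp add: degree_mult_eq)
      also have "\<dots> \<le> j" using hj by (simp add: degree_diff_le degree_monom_eq flip: eq)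
      finally have "degree (monom 1 i * q) + r \<le> 2 * s + 1"
        using degree_mult_le[of "monom 1 i" q] i j by (simp add: degree_monom_eq)
      then have "riesz y (2 * s + 1) (p * (monom 1 i * q)) = 0" by (rule gauss_poly_orthogonal[OF g])
      then show ?thesis by (simp add: mult.left_commute)
    qed (simp add: riesz_def)
    then have "riesz y (2 * s + 1) (monom 1 i * (1 * h)) = riesz y (2 * s + 1) (monom 1 (i + j))"
      by (simp add: eq[symmetric] right_diff_distrib riesz_diff mult_monom)
    moreover have "riesz y (2 * s + 1) (monom 1 i * (1 * h)) =
        (\<Sum>k<1. \<Sum>l<r. coeff 1 k * coeff h l * y (k + l + i))"
      using i p(3) h0 by (intro riesz_mult) (auto simp: coeff_eq_0)
    moreover have "riesz y (2 * s + 1) (monom 1 (i + j)) = y (i + j)"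
      using i j by (simp add: riesz_monom)
    ultimately show ?thesis by (simp add: H1_def mult_ac add_ac)
  qed
  then show "\<exists>c. \<forall>i\<le>s. H1 y i j = (\<Sum>k<r. H1 y i k * c k)" by blast
qed

text \<open>Row i says that x^r - \<open>Poly gs\<close> is orthogonal to x^i. The rows with i < r
  are present since 2 r <= 2 s + 2, and they already determine p; the remaining rows hold by the
  extended orthogonality of p.\<close>

lemma hankel_system_iff:
  fixes gs :: "real list"
  assumes H: "hausdorff_functional (riesz y (2 * s + 1)) s"
    and g: "hausdorff_functional.gauss_poly (riesz y (2 * s + 1)) s r p"
    and len: "length gs = r"
  shows "(\<forall>i\<le>2 * s + 1 - r. (\<Sum>j<r. y (i + j) * gs ! j) = y (i + r)) \<longleftrightarrow> monom 1 r - Poly gs = p"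
proof -
  interpret hausdorff_functional "riesz y (2 * s + 1)" s by (rule H)
  have r: "r \<le> Suc s" by (rule gauss_polyD(3)[OF g])
  define q where "q = monom 1 r - Poly gs"
  have coeff_gs: "coeff (Poly gs) k = (if k < r then gs ! k else 0)" for k
    by (simp add: coeff_Poly_eq nth_default_def len)
  have coeff_q: "coeff q r = 1" "\<And>k. k > r \<Longrightarrow> coeff q k = 0"
    by (simp_all add: q_def coeff_gs del: coeff_Poly_eq)
  then have q: "degree q = r" "lead_coeff q = 1"
    using degree_le[of r q] le_degree[of q r] by (simp_all add: le_antisym)
  have L: "riesz y (2 * s + 1) (q * monom 1 i) = y (i + r) - (\<Sum>j<r. y (i + j) * gs ! j)"
    if "i \<le> 2 * s + 1 - r" for i
  proof -
    have "riesz y (2 * s + 1) (monom 1 i * (1 * Poly gs)) =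
        (\<Sum>k<1. \<Sum>j<r. coeff 1 k * coeff (Poly gs) j * y (k + j + i))"
      using that r by (intro riesz_mult) (auto simp: coeff_eq_0 coeff_gs simp del: coeff_Poly_eq)
    moreover have "q * monom 1 i = monom 1 (i + r) - monom 1 i * (1 * Poly gs)"
      by (simp add: q_def left_diff_distrib mult_monom mult.commute[of "monom 1 i"] add.commute)
    ultimately show ?thesis
      using that r by (simp add: riesz_diff riesz_monom coeff_gs ac_simps del: coeff_Poly_eq)
  qed
  show ?thesis
  proof
    assume sys: "\<forall>i\<le>2 * s + 1 - r. (\<Sum>j<r. y (i + j) * gs ! j) = y (i + r)"
    have "riesz y (2 * s + 1) (q * f) = 0" if f: "degree f < r" for f
    proof -
      have "q * f = (\<Sum>i<r. Polynomial.smult (coeff f i) (q * monom 1 i))"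
        using f by (subst poly_eq_sum_monom[of r f])
          (simp_all add: coeff_eq_0 sum_distrib_left smult_monom flip: mult_smult_right)
      then show ?thesis using L sys r by (simp add: riesz_sum riesz_smult)
    qed
    then show "monom 1 r - Poly gs = p" using gauss_poly_unique[OF g q] by (simp add: q_def)
  next
    assume "monom 1 r - Poly gs = p"
    then have "riesz y (2 * s + 1) (q * monom 1 i) = 0" if "i \<le> 2 * s + 1 - r" for i
      using gauss_poly_orthogonal[OF g, of "monom 1 i"] that r by (simp add: q_def degree_monom_eq)
    then show "\<forall>i\<le>2 * s + 1 - r. (\<Sum>j<r. y (i + j) * gs ! j) = y (i + r)" using L by simp
  qed
qed

text \<open>The moment side of the result. The last clause, with at most r nodes and arbitrary real
  weights, is the common source of uniqueness for weights, measure and cp-rank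
  decomposition.\<close>

theorem truncated_hausdorff:
  fixes y :: "nat \<Rightarrow> real"
  assumes "psd s (H3 y)" "psd s (H4 y)"
  defines "d \<equiv> 2 * s + 1" and "r \<equiv> mat_rank s (H1 y)"
  obtains p w where
    "degree p = r" "lead_coeff p = 1" "card {x. poly p x = 0} = r" "{x. poly p x = 0} \<subseteq> {0..1}"
    "\<And>x. poly p x = 0 \<Longrightarrow> w x > 0"
    "\<And>k. k \<le> d \<Longrightarrow> y k = (\<Sum>x | poly p x = 0. w x * x ^ k)"
    "\<And>gs. length gs = r \<Longrightarrow>
      (\<forall>i\<le>d - r. (\<Sum>j<r. y (i + j) * gs ! j) = y (i + r)) \<longleftrightarrow> monom 1 r - Poly gs = p"
    "\<And>S v. finite S \<Longrightarrow> card S \<le> r \<Longrightarrow> (\<And>k. k \<le> d \<Longrightarrow> y k = (\<Sum>x\<in>S. v x * x ^ k)) \<Longrightarrow>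
      S = {x. poly p x = 0} \<and> (\<forall>x\<in>S. v x = w x)"
proof -
  have H: "hausdorff_functional (riesz y d) s"
    unfolding d_def by (rule hausdorff_functional_riesz) fact+
  interpret hausdorff_functional "riesz y d" s by (rule H)
  obtain r' p where "gauss_poly r' p" using gauss_poly_exists by blast
  moreover from this have "r' = r"
    using mat_rank_gauss_poly[OF H[unfolded d_def]] by (simp add: r_def d_def)
  ultimately have g: "gauss_poly r p" by simp
  define R where "R = {x. poly p x = 0}"
  define w where "w x = riesz y d (lagrange_poly R x)" for x
  show thesis
  proof (rule that[of p w])
    show "degree p = r" "lead_coeff p = 1" using gauss_polyD[OF g] by auto
    show "card {x. poly p x = 0} = r" by (rule gauss_poly_card_roots[OF g])
    show "{x. poly p x = 0} \<subseteq> {0..1}" using gauss_poly_root_bounds[OF g] by blast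
    show "w x > 0" if "poly p x = 0" for x
      using gauss_weight_pos[OF g] that by (simp add: w_def R_def)
    show "y k = (\<Sum>x | poly p x = 0. w x * x ^ k)" if "k \<le> d" for k
      using gauss_quadrature[OF g, of "monom 1 k"] that
      by (simp add: riesz_monom degree_monom_eq d_def w_def R_def poly_monom)
    show "(\<forall>i\<le>d - r. (\<Sum>j<r. y (i + j) * gs ! j) = y (i + r)) \<longleftrightarrow> monom 1 r - Poly gs = p"
      if "length gs = r" for gs
      unfolding d_def by (rule hankel_system_iff[OF H[unfolded d_def] g[unfolded d_def] that])
    show "S = {x. poly p x = 0} \<and> (\<forall>x\<in>S. v x = w x)"
      if S: "finite S" "card S \<le> r" and y: "\<And>k. k \<le> d \<Longrightarrow> y k = (\<Sum>x\<in>S. v x * x ^ k)" for S v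
    proof -
      have quad: "riesz y d f = (\<Sum>x\<in>S. v x * poly f x)" if f: "degree f \<le> 2 * s + 1" for f
      proof -
        have "riesz y d f = (\<Sum>k\<le>d. \<Sum>x\<in>S. v x * (coeff f k * x ^ k))"
          unfolding riesz_def by (intro sum.cong) (simp_all add: y sum_distrib_left mult_ac)
        also have "\<dots> = (\<Sum>x\<in>S. v x * (\<Sum>k\<le>d. coeff f k * x ^ k))"
          by (subst sum.swap) (simp add: sum_distrib_left)
        also have "\<dots> = (\<Sum>x\<in>S. v x * poly f x)"
          unfolding poly_altdef using f
          by (intro sum.cong arg_cong2[where f = "(*)"] refl sum.mono_neutral_right)
            (auto simp: d_def coeff_eq_0)
        finally show ?thesis .
      qed
      have "S = R" unfolding R_def by (rule quadrature_unique(1)[OF g S quad])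
      then show ?thesis
        using quadrature_unique(2)[OF g S quad] by (simp add: w_def R_def)
    qed
  qed
qed

section \<open>Symmetric binary tensors\<close>

lemma idx_0: "idx 0 = {[]}"
  by (auto simp: idx_def)

lemma idx_Suc: "idx (Suc d) = (\<lambda>(a, xs). a # xs) ` ({1, 2} \<times> idx d)"
  by (auto simp: idx_def length_Suc_conv image_iff)

lemma finite_idx: "finite (idx d)"
  by (induction d) (auto simp: idx_0 idx_Suc)

lemma sum_idx_Suc: "(\<Sum>js\<in>idx (Suc d). f js) = (\<Sum>a\<in>{1, 2}. \<Sum>js\<in>idx d. f (a # js))"
proof -
  have "(\<Sum>js\<in>idx (Suc d). f js) = (\<Sum>(a, js)\<in>{1, 2} \<times> idx d. f (a # js))"
    unfolding idx_Suc by (subst sum.reindex) (auto simp: inj_on_def case_prod_beta)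
  then show ?thesis by (simp add: sum.cartesian_product)
qed

text \<open>The map acts factorwise: the sum over index lists is a product of sums over single
  indices, each computing an entry of T v.\<close>

lemma LT_tpow: "LT d (tpow d v) = tpow d (fst v + snd v, snd v)"
proof -
  have "(\<Sum>js\<in>idx d. (\<Prod>k<d. Tmat (xs ! k) (js ! k)) * prod_list (map (comp2 v) js)) =
      prod_list (map (comp2 (fst v + snd v, snd v)) xs)" if "xs \<in> idx d" for xs
    using that
  proof (induction d arbitrary: xs)
    case 0
    then show ?case by (simp add: idx_0)
  next
    case (Suc d)
    then obtain a zs where xs: "xs = a # zs" "a \<in> {1, 2}" "zs \<in> idx d" by (auto simp: idx_Suc)
    let ?R = "prod_list (map (comp2 (fst v + snd v, snd v)) zs)"
    have "(\<Sum>js\<in>idx (Suc d). (\<Prod>k<Suc d. Tmat (xs ! k) (js ! k)) * prod_list (map (comp2 v) js)) =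
        (\<Sum>b\<in>{1, 2}. Tmat a b * comp2 v b *
          (\<Sum>js\<in>idx d. (\<Prod>k<d. Tmat (zs ! k) (js ! k)) * prod_list (map (comp2 v) js)))"
      unfolding sum_idx_Suc sum_distrib_left
      by (intro sum.cong refl) (simp add: xs prod.lessThan_Suc_shift del: prod.lessThan_Suc)
    also have "\<dots> = (\<Sum>b\<in>{1, 2}. Tmat a b * comp2 v b) * ?R"
      by (simp only: Suc.IH[OF xs(3)] sum_distrib_right)
    also have "(\<Sum>b\<in>{1, 2}. Tmat a b * comp2 v b) = comp2 (fst v + snd v, snd v) a"
      using xs(2) by (auto simp: Tmat_def comp2_def)
    finally show ?case by (simp add: xs(1))
  qed
  then show ?thesis by (intro ext) (simp add: LT_def tpow_def cong: sum.cong)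
qed

lemma LT_sum_list: "LT d (\<lambda>xs. \<Sum>v\<leftarrow>vs. f v xs) zs = (\<Sum>v\<leftarrow>vs. LT d (f v) zs)"
  by (induction vs) (auto simp: LT_def sum.distrib distrib_left)

lemma replicate_in_idx: "k \<le> d \<Longrightarrow> replicate (d - k) 1 @ replicate k 2 \<in> idx d"
  by (auto simp: idx_def)

lemma Bvec_LT_tpow: "k \<le> d \<Longrightarrow> Bvec d (LT d (tpow d v)) k = (fst v + snd v) ^ (d - k) * snd v ^ k"
  unfolding LT_tpow by (simp add: Bvec_def tpow_def replicate_in_idx comp2_def prod_list_replicate
      del: One_nat_def)

lemma sym_tensor_tpow: "sym_tensor d (tpow d v)"
proof -
  have "prod_list (map (comp2 v) xs) = prod_mset (image_mset (comp2 v) (mset xs))" for xs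
    by (simp add: prod_mset_prod_list flip: mset_map)
  then show ?thesis by (simp add: sym_tensor_def tpow_def)
qed

lemma sym_tensorD:
  "sym_tensor d X \<Longrightarrow> xs \<in> idx d \<Longrightarrow> ys \<in> idx d \<Longrightarrow> mset xs = mset ys \<Longrightarrow> X xs = X ys"
  unfolding sym_tensor_def by blast

text \<open>Covers sums and differences at once; \<open>f 0 0 = 0\<close> preserves vanishing
  outside \<open>idx d\<close>.\<close>

lemma sym_tensor_combine:
  assumes "sym_tensor d X" "sym_tensor d Y" "f 0 0 = 0"
  shows "sym_tensor d (\<lambda>xs. f (X xs) (Y xs))"
  unfolding sym_tensor_def
proof (intro conjI allI impI, goal_cases)
  case (1 xs ys)
  then show ?case using sym_tensorD[OF assms(1), of xs ys] sym_tensorD[OF assms(2), of xs ys] by simp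
next
  case (2 xs)
  then show ?case using assms by (simp add: sym_tensor_def)
qed

lemma sym_tensor_sum_list:
  "(\<And>v. v \<in> set vs \<Longrightarrow> sym_tensor d (f v)) \<Longrightarrow> sym_tensor d (\<lambda>xs. \<Sum>v\<leftarrow>vs. f v xs)"
proof (induction vs)
  case (Cons v vs)
  then have "sym_tensor d (f v)" "sym_tensor d (\<lambda>xs. \<Sum>v\<leftarrow>vs. f v xs)" by auto
  then show ?case using sym_tensor_combine[of d "f v" _ "(+)"] by simp
qed (simp add: sym_tensor_def)

lemma count_idx: "xs \<in> idx d \<Longrightarrow> count (mset xs) 1 + count (mset xs) 2 = d"
proof (induction d arbitrary: xs)
  case (Suc d)
  then show ?case by (auto simp: idx_Suc)
qed (simp add: idx_0)

lemma mset_idx: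
  assumes "xs \<in> idx d"
  shows "mset xs = mset (replicate (d - count (mset xs) 2) 1 @ replicate (count (mset xs) 2) 2)"
proof (rule multiset_eqI)
  fix i
  show "count (mset xs) i =
      count (mset (replicate (d - count (mset xs) 2) 1 @ replicate (count (mset xs) 2) 2)) i"
  proof (cases "i \<in> {1, 2}")
    case False
    then have "i \<notin> set xs" using assms by (auto simp: idx_def)
    then show ?thesis using False by (simp add: not_in_iff)
  qed (use count_idx[OF assms] in auto)
qed

text \<open>\<open>L\<^sub>T\<close> is unitriangular with respect to the number of entries equal to 2, hence injective.\<close>

lemma sym_tensor_eq_0I:
  assumes sym: "sym_tensor d Z" and B: "\<And>k. k \<le> d \<Longrightarrow> Bvec d (LT d Z) k = 0"
  shows "Z xs = 0"
proof (cases "xs \<in> idx d")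
  case True
  then show ?thesis
  \<comment> \<open>Induction on the number of entries equal to 1, starting from the list of all
    2s.\<close>
  proof (induction "d - count (mset xs) 2" arbitrary: xs rule: less_induct)
    case less
    define k where "k = count (mset xs) 2"
    have k: "k \<le> d" using count_idx[OF less.prems] by (simp add: k_def)
    define row where "row = replicate (d - k) (1 :: nat) @ replicate k 2"
    have row: "row \<in> idx d" unfolding row_def by (rule replicate_in_idx[OF k])
    \<comment> \<open>A 1 of \<open>js\<close> under a 2 of \<open>row\<close> meets the zero entry
      of T. Any other \<open>js\<close> different from \<open>row\<close> contains more 2s, so the
      induction hypothesis gives \<open>Z js = 0\<close>.\<close>
    have zero: "(\<Prod>i<d. Tmat (row ! i) (js ! i)) * Z js = 0" if js: "js \<in> idx d" "js \<noteq> row" for js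
    proof (cases "\<exists>i<d. row ! i = 2 \<and> js ! i = 1")
      case True
      then have "(\<Prod>i<d. Tmat (row ! i) (js ! i)) = 0" by (auto simp: Tmat_def intro!: prod_zero)
      then show ?thesis by simp
    next
      case False
      have len: "length js = d" and set: "set js \<subseteq> {1, 2}" using js(1) by (auto simp: idx_def)
      have two: "js ! i = 2" if "d - k \<le> i" "i < d" for i
      proof -
        have "row ! i = 2" using that by (simp add: row_def nth_append)
        moreover have "js ! i \<in> {1, 2}" using set that(2) len nth_mem by blast
        ultimately show ?thesis using False that by auto
      qed
      have "drop (d - k) js = replicate k 2"
        using len k two by (intro nth_equalityI) auto
      then have js_eq: "js = take (d - k) js @ replicate k 2" by (metis append_take_drop_id)
      have "2 \<in> set (take (d - k) js)"
      proof (rule ccontr)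
        assume "2 \<notin> set (take (d - k) js)"
        then have "\<forall>x\<in>set (take (d - k) js). x = 1" using set set_take_subset[of "d - k" js] by auto
        then have "take (d - k) js = replicate (d - k) 1"
          using len replicate_eqI[of "take (d - k) js" "d - k" 1] by simp
        then show False using js_eq js(2) by (simp add: row_def)
      qed
      then have "count (mset (take (d - k) js)) 2 > 0" by simp
      then have "k < count (mset js) 2" by (subst js_eq) simp
      then have "d - count (mset js) 2 < d - count (mset xs) 2"
        using count_idx[OF js(1)] by (simp add: k_def)
      then show ?thesis using less.hyps js(1) by simp
    qed
    have "0 = LT d Z row" using B[OF k] by (simp add: Bvec_def row_def)
    also have "\<dots> = (\<Sum>js\<in>idx d. (\<Prod>i<d. Tmat (row ! i) (js ! i)) * Z js)"
      by (simp add: LT_def row)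
    also have "\<dots> = (\<Sum>js\<in>{row}. (\<Prod>i<d. Tmat (row ! i) (js ! i)) * Z js)"
      using zero row finite_idx by (intro sum.mono_neutral_right) auto
    also have "\<dots> = Z row" by (simp add: Tmat_def)
    finally have "Z row = 0" ..
    moreover have "mset xs = mset row" using mset_idx[OF less.prems] by (simp only: row_def k_def)
    ultimately show ?case using sym_tensorD[OF sym less.prems row] by simp
  qed
qed (use sym in \<open>simp add: sym_tensor_def\<close>)

lemma sym_tensor_eqI:
  assumes X: "sym_tensor d X" and Y: "sym_tensor d Y"
    and eq: "\<And>k. k \<le> d \<Longrightarrow> Bvec d (LT d X) k = Bvec d (LT d Y) k"
  shows "X = Y"
proof
  fix xs
  have "sym_tensor d (\<lambda>xs. X xs - Y xs)" by (rule sym_tensor_combine[OF X Y]) simp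
  moreover have "LT d (\<lambda>xs. X xs - Y xs) zs = LT d X zs - LT d Y zs" for zs
    by (simp add: LT_def right_diff_distrib sum_subtractf)
  then have "Bvec d (LT d (\<lambda>xs. X xs - Y xs)) k = 0" if "k \<le> d" for k
    using eq[OF that] by (simp add: Bvec_def)
  ultimately have "X xs - Y xs = 0" by (rule sym_tensor_eq_0I)
  then show "X xs = Y xs" by simp
qed

text \<open>Reduces a tensor identity to d + 1 scalar equations; the backward direction is the
  injectivity of the transformation on symmetric tensors.\<close>

lemma tensor_decomposition_iff:
  assumes "sym_tensor d A"
  shows "A = (\<lambda>zs. \<Sum>v\<leftarrow>vs. tpow d v zs) \<longleftrightarrow>
    (\<forall>k\<le>d. Bvec d (LT d A) k = (\<Sum>v\<leftarrow>vs. (fst v + snd v) ^ (d - k) * snd v ^ k))"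
proof -
  let ?S = "\<lambda>zs. \<Sum>v\<leftarrow>vs. tpow d v zs"
  have B: "Bvec d (LT d ?S) k = (\<Sum>v\<leftarrow>vs. (fst v + snd v) ^ (d - k) * snd v ^ k)" if "k \<le> d" for k
  proof -
    have "Bvec d (LT d ?S) k = (\<Sum>v\<leftarrow>vs. Bvec d (LT d (tpow d v)) k)"
      by (simp add: Bvec_def LT_sum_list)
    then show ?thesis by (simp only: Bvec_LT_tpow[OF that])
  qed
  have "sym_tensor d ?S" by (intro sym_tensor_sum_list sym_tensor_tpow)
  then show ?thesis using sym_tensor_eqI[OF assms, of ?S] B by auto
qed

section \<open>Finitely atomic measures\<close>

text \<open>The complement of the support is a union of null balls, and by Lindelof countably many
  of them suffice.\<close>

lemma AE_in_msupport:
  assumes [measurable_cong]: "sets \<mu> = sets borel"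
  shows "AE x in \<mu>. x \<in> msupport \<mu>"
proof -
  define F where "F = {ball x e | x e. e > 0 \<and> emeasure \<mu> (ball x e) = 0}"
  have "\<And>S. S \<in> F \<Longrightarrow> open S" by (auto simp: F_def)
  then obtain F' where F': "F' \<subseteq> F" "countable F'" "\<Union>F' = \<Union>F"
    by (rule Lindelof)
  have "S \<in> null_sets \<mu>" if "S \<in> F'" for S
    using that F'(1) assms by (auto simp: F_def null_sets_def)
  then have "\<Union>F' \<in> null_sets \<mu>" using F'(2) by (intro null_sets_UN'[of F' "\<lambda>S. S", simplified])
  moreover have "x \<in> \<Union>F" if "x \<notin> msupport \<mu>" for x
  proof -
    obtain e where "e > 0" "emeasure \<mu> (ball x e) = 0"
      using \<open>x \<notin> msupport \<mu>\<close> by (auto simp: msupport_def not_less)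
    then show ?thesis by (auto simp: F_def intro!: exI[of _ "ball x e"])
  qed
  ultimately show ?thesis by (intro AE_I'[of "\<Union>F'"]) (auto simp: F')
qed

lemma representing_finite_measure:
  assumes "representing d y \<mu>" shows "finite_measure \<mu>"
proof
  \<comment> \<open>Integrability of the constant 1, the case k = 0, bounds the total mass.\<close>
  have "integrable \<mu> (\<lambda>x. x ^ 0)" using assms unfolding representing_def by blast
  then show "emeasure \<mu> (space \<mu>) \<noteq> \<infinity>" by (simp add: integrable_iff_bounded)
qed

lemma emeasure_finite_msupport:
  assumes sets: "sets \<mu> = sets borel" and fin: "finite (msupport \<mu>)" and B: "B \<in> sets borel"
  shows "emeasure \<mu> B = (\<Sum>x\<in>msupport \<mu> \<inter> B. emeasure \<mu> {x})"
proof -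
  have "emeasure \<mu> B = emeasure \<mu> (msupport \<mu> \<inter> B)"
    using AE_in_msupport[OF sets] B fin sets
    by (intro emeasure_eq_AE) (auto intro!: sets.Int finite_imp_closed borel_closed)
  also have "\<dots> = (\<Sum>x\<in>msupport \<mu> \<inter> B. emeasure \<mu> {x})"
    using fin sets by (intro emeasure_eq_sum_singleton) auto
  finally show ?thesis .
qed

lemma representing_finite_msupport:
  assumes rep: "representing d y \<mu>" and fin: "finite (msupport \<mu>)" and k: "k \<le> d"
  shows "y k = (\<Sum>x\<in>msupport \<mu>. measure \<mu> {x} * x ^ k)"
proof -
  interpret finite_measure \<mu> by (rule representing_finite_measure[OF rep])
  have sets[measurable_cong]: "sets \<mu> = sets borel" using rep by (simp add: representing_def)
  have "y k = (\<integral>x. x ^ k \<partial>\<mu>)" using rep k by (simp add: representing_def)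
  also have "\<dots> = (\<integral>x. (\<Sum>a\<in>msupport \<mu>. a ^ k * indicator {a} x) \<partial>\<mu>)"
  proof (rule integral_cong_AE)
    show "AE x in \<mu>. x ^ k = (\<Sum>a\<in>msupport \<mu>. a ^ k * indicator {a} x)"
      using AE_in_msupport[OF sets]
    proof eventually_elim
      case (elim x)
      then have "(\<Sum>a\<in>msupport \<mu>. a ^ k * indicator {a} x) = (\<Sum>a\<in>msupport \<mu>. if a = x then x ^ k else 0)"
        by (intro sum.cong) (auto simp: indicator_def)
      then show ?case using elim fin by simp
    qed
  qed measurable
  also have "\<dots> = (\<Sum>a\<in>msupport \<mu>. a ^ k * measure \<mu> {a})"
    using sets fin by (subst Bochner_Integration.integral_sum) (auto simp: emeasure_finite less_top[symmetric])
  finally show ?thesis by (simp add: mult.commute)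
qed

text \<open>\<open>point_measure\<close> lives on the subsets of \<open>R\<close>; pushing it
  forward along the identity gives a Borel measure on the line.\<close>

definition atomic_measure :: "real set \<Rightarrow> (real \<Rightarrow> real) \<Rightarrow> real measure" where
  "atomic_measure R w = distr (point_measure R (\<lambda>x. ennreal (w x))) borel (\<lambda>x. x)"

lemma emeasure_atomic_measure:
  assumes "finite R" "B \<in> sets borel"
  shows "emeasure (atomic_measure R w) B = (\<Sum>x\<in>B \<inter> R. ennreal (w x))"
  using assms unfolding atomic_measure_def
  by (subst emeasure_distr) (auto simp: space_point_measure emeasure_point_measure_finite)

lemma msupport_atomic_measure:
  assumes R: "finite R" and w: "\<And>x. x \<in> R \<Longrightarrow> w x > 0"
  shows "msupport (atomic_measure R w) = R"
proof (intro equalityI subsetI)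
  fix x assume x: "x \<in> R"
  have "emeasure (atomic_measure R w) (ball x e) > 0" if "e > 0" for e
  proof -
    have "0 < ennreal (w x)" using w[OF x] by simp
    also have "\<dots> \<le> (\<Sum>z\<in>ball x e \<inter> R. ennreal (w z))"
      using that x R by (intro member_le_sum) auto
    finally show ?thesis by (simp add: emeasure_atomic_measure[OF R])
  qed
  then show "x \<in> msupport (atomic_measure R w)" by (simp add: msupport_def)
next
  fix x assume x: "x \<in> msupport (atomic_measure R w)"
  show "x \<in> R"
  proof (rule ccontr)
    assume "x \<notin> R"
    then obtain e where e: "e > 0" "ball x e \<subseteq> - R"
      using finite_imp_closed[OF R] by (meson ComplI open_Compl open_contains_ball)
    then have "emeasure (atomic_measure R w) (ball x e) = (\<Sum>x\<in>{}. ennreal (w x))"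
      using R by (subst emeasure_atomic_measure) (auto intro!: sum.cong)
    then show False using x e(1) by (auto simp: msupport_def)
  qed
qed

lemma representing_atomic_measure:
  assumes R: "finite R" and w: "\<And>x. x \<in> R \<Longrightarrow> w x > 0"
    and y: "\<And>k. k \<le> d \<Longrightarrow> y k = (\<Sum>x\<in>R. w x * x ^ k)"
  shows "representing d y (atomic_measure R w)"
proof -
  have w': "\<And>x. x \<in> R \<Longrightarrow> w x \<ge> 0" using w by (simp add: less_imp_le)
  have "(\<integral>x. x ^ k \<partial>atomic_measure R w) = (\<Sum>x\<in>R. w x * x ^ k)" for k
    unfolding atomic_measure_def
    by (subst integral_distr) (auto simp: lebesgue_integral_point_measure_finite R w')
  moreover have "integrable (atomic_measure R w) (\<lambda>x. x ^ k)" for k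
    unfolding atomic_measure_def
    by (subst integrable_distr_eq) (auto simp: integrable_point_measure_finite R)
  ultimately show ?thesis using y by (simp add: representing_def atomic_measure_def)
qed

lemma measure_eqI_finite_msupport:
  assumes "sets \<mu> = sets borel" "sets \<nu> = sets borel" "finite (msupport \<mu>)"
    and "msupport \<mu> = msupport \<nu>" "finite_measure \<mu>" "finite_measure \<nu>"
    and eq: "\<And>x. x \<in> msupport \<mu> \<Longrightarrow> measure \<mu> {x} = measure \<nu> {x}"
  shows "\<mu> = \<nu>"
proof (rule measure_eqI)
  fix B assume "B \<in> sets \<mu>"
  then have "B \<in> sets borel" using assms(1) by simp
  moreover have "emeasure \<mu> {x} = emeasure \<nu> {x}" if "x \<in> msupport \<mu>" for x
    using eq[OF that] assms(5,6) by (simp add: finite_measure.emeasure_eq_measure)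
  ultimately show "emeasure \<mu> B = emeasure \<nu> B"
    using emeasure_finite_msupport[of \<mu> B] emeasure_finite_msupport[of \<nu> B] assms by simp
qed (use assms in simp)

section \<open>Uniqueness of the decomposition and of the measure\<close>

text \<open>Merges the list entries that share a node. This is how parallel or repeated vectors of a
  decomposition become one atom with the summed weight.\<close>

lemma sum_list_group:
  fixes u :: "'a \<Rightarrow> 'c::semiring_0"
  assumes "finite X" "t ` set ws \<subseteq> X"
  shows "(\<Sum>v\<leftarrow>ws. u v * f (t v)) = (\<Sum>x\<in>X. (\<Sum>v\<leftarrow>ws. if t v = x then u v else 0) * f x)"
  using assms(2)
proof (induction ws)
  case (Cons v ws)
  have "(\<Sum>x\<in>X. (if t v = x then u v else 0) * f x) = (\<Sum>x\<in>X. if t v = x then u v * f x else 0)"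
    by (intro sum.cong) auto
  also have "\<dots> = u v * f (t v)" using Cons.prems assms(1) by simp
  finally show ?case using Cons by (simp add: distrib_right sum.distrib)
qed simp

lemma root_power:
  assumes "d > 0" "(S::real) > 0" shows "(S ^ d) powr (1 / real d) = S"
  using assms by (simp add: powr_powr flip: powr_realpow)

lemma power_root:
  assumes "d > 0" "(w::real) > 0" shows "(w powr (1 / real d)) ^ d = w"
  using assms by (simp add: powr_powr flip: powr_realpow)

text \<open>No case distinction for the zero vector is needed: it becomes the atom \<open>0 / 0 = 0\<close> of weight 0.\<close>

lemma sum_power_split:
  fixes a b :: real
  assumes "a \<ge> 0" "b \<ge> 0" "k \<le> d" "d > 0"
  shows "(a + b) ^ (d - k) * b ^ k = (a + b) ^ d * (b / (a + b)) ^ k"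
proof (cases "a + b = 0")
  case True
  then have "a = 0" "b = 0" using assms by linarith+
  then show ?thesis using assms(4) by (cases "k = 0") simp_all
next
  case False
  then show ?thesis using assms(3) by (simp add: power_divide power_diff)
qed

lemma cp_rank_unique_decomposition:
  fixes w :: "real \<Rightarrow> real"
  assumes d: "d > 0" and A: "sym_tensor d A" and R: "finite R" "R \<subseteq> {0..1}"
    and w: "\<And>x. x \<in> R \<Longrightarrow> w x > 0"
    and y: "\<And>k. k \<le> d \<Longrightarrow> Bvec d (LT d A) k = (\<Sum>x\<in>R. w x * x ^ k)"
    and uniq: "\<And>S v. finite S \<Longrightarrow> card S \<le> card R \<Longrightarrow>
      (\<And>k. k \<le> d \<Longrightarrow> Bvec d (LT d A) k = (\<Sum>x\<in>S. v x * x ^ k)) \<Longrightarrow>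
      S = R \<and> (\<forall>x\<in>S. v x = w x)"
  defines "V \<equiv> \<lambda>x. (w x powr (1 / real d) * (1 - x), w x powr (1 / real d) * x)"
  assumes xs: "distinct xs" "set xs = R"
  shows "cp_decomp d A (map V xs)" "cp_rank d A = card R"
    "length ws = card R \<Longrightarrow> cp_decomp d A ws \<Longrightarrow> mset ws = mset (map V xs)"
proof -
  show dec: "cp_decomp d A (map V xs)"
    unfolding cp_decomp_def
  proof
    show "\<forall>v\<in>set (map V xs). 0 \<le> fst v \<and> 0 \<le> snd v"
      using R(2) xs(2) by (auto simp: V_def)
    have "(\<Sum>v\<leftarrow>map V xs. (fst v + snd v) ^ (d - k) * snd v ^ k) = Bvec d (LT d A) k" if k: "k \<le> d" for k
    proof -
      have "(fst (V x) + snd (V x)) ^ (d - k) * snd (V x) ^ k = w x * x ^ k" if x: "x \<in> R" for x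
      proof -
        define c where "c = w x powr (1 / real d)"
        have "fst (V x) + snd (V x) = c" "snd (V x) = c * x"
          by (simp_all add: V_def c_def algebra_simps)
        moreover have "c ^ (d - k) * (c * x) ^ k = c ^ d * x ^ k"
          using k by (simp add: power_mult_distrib flip: power_add mult.assoc)
        moreover have "c ^ d = w x" unfolding c_def by (rule power_root[OF d w[OF x]])
        ultimately show ?thesis by simp
      qed
      then show ?thesis
        using xs k by (simp add: y o_def sum_list_distinct_conv_sum_set)
    qed
    then show "A = (\<lambda>zs. \<Sum>v\<leftarrow>map V xs. tpow d v zs)"
      using tensor_decomposition_iff[OF A, of "map V xs"] by simp
  qed
  \<comment> \<open>Node and weight of the atom coming from a vector.\<close>
  define t u where "t v = snd v / (fst v + snd v)" and "u v = (fst v + snd v) ^ d" for v :: "real \<times> real"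
  \<comment> \<open>The merged atoms of a decomposition with at most \<open>card R\<close> vectors
    satisfy the moment equations, so \<open>uniq\<close> applies. Both minimality and uniqueness
    follow from this.\<close>
  have short: "t ` set ws = R \<and> (\<forall>x\<in>R. (\<Sum>v\<leftarrow>ws. if t v = x then u v else 0) = w x)"
    if ws: "cp_decomp d A ws" "length ws \<le> card R" for ws
  proof -
    have nn: "\<And>v. v \<in> set ws \<Longrightarrow> fst v \<ge> 0 \<and> snd v \<ge> 0" and "A = (\<lambda>zs. \<Sum>v\<leftarrow>ws. tpow d v zs)"
      using ws(1) by (simp_all add: cp_decomp_def)
    have "Bvec d (LT d A) k = (\<Sum>x\<in>t ` set ws. (\<Sum>v\<leftarrow>ws. if t v = x then u v else 0) * x ^ k)"
      if k: "k \<le> d" for k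
    proof -
      have "Bvec d (LT d A) k = (\<Sum>v\<leftarrow>ws. (fst v + snd v) ^ (d - k) * snd v ^ k)"
        using tensor_decomposition_iff[OF A, of ws] \<open>A = _\<close> k by blast
      also have "\<dots> = (\<Sum>v\<leftarrow>ws. u v * t v ^ k)"
        using nn k d by (intro arg_cong[where f = sum_list] map_cong) (simp_all add: u_def t_def sum_power_split)
      also have "\<dots> = (\<Sum>x\<in>t ` set ws. (\<Sum>v\<leftarrow>ws. if t v = x then u v else 0) * x ^ k)"
        by (rule sum_list_group) auto
      finally show ?thesis .
    qed
    moreover have "card (t ` set ws) \<le> card R"
      using card_image_le[of "set ws" t] card_length[of ws] ws(2) by simp
    ultimately have "t ` set ws = R \<and>
        (\<forall>x\<in>t ` set ws. (\<Sum>v\<leftarrow>ws. if t v = x then u v else 0) = w x)"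
      by (intro uniq[of "t ` set ws" "\<lambda>x. \<Sum>v\<leftarrow>ws. if t v = x then u v else 0"]) simp_all
    then show ?thesis by metis
  qed
  show "cp_rank d A = card R"
    unfolding cp_rank_def
  proof (rule Least_equality)
    show "\<exists>vs. length vs = card R \<and> cp_decomp d A vs"
      using dec xs distinct_card[OF xs(1)] by (intro exI[of _ "map V xs"]) simp
    fix m assume "\<exists>vs. length vs = m \<and> cp_decomp d A vs"
    then obtain ws where ws: "length ws = m" "cp_decomp d A ws" by blast
    show "card R \<le> m"
    proof (rule ccontr)
      assume "\<not> card R \<le> m"
      then have "t ` set ws = R" using short ws by simp
      then have "card R \<le> m" using card_image_le[of "set ws" t] card_length[of ws] ws(1) by simp
      then show False using \<open>\<not> card R \<le> m\<close> by simp
    qed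
  qed
  show "mset ws = mset (map V xs)" if len: "length ws = card R" and ws: "cp_decomp d A ws" for ws
  proof -
    have tws: "t ` set ws = R" and sums: "\<And>x. x \<in> R \<Longrightarrow> (\<Sum>v\<leftarrow>ws. if t v = x then u v else 0) = w x"
      using short[OF ws] len by auto
    \<comment> \<open>\<open>card R\<close> list entries map onto \<open>R\<close>, so no two share
      a node and each weight comes from a single vector.\<close>
    then have dist: "distinct (map t ws)" using len by (intro card_distinct) simp
    have "v = V (t v)" if v: "v \<in> set ws" for v
    proof -
      have nn: "fst v \<ge> 0" "snd v \<ge> 0" using ws v by (simp_all add: cp_decomp_def)
      have tv: "t v \<in> R" using tws v by blast
      have "w (t v) = (\<Sum>v'\<leftarrow>ws. if t v' = t v then u v' else 0)" using sums[OF tv] by simp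
      also have "\<dots> = (\<Sum>v'\<in>set ws. if t v' = t v then u v' else 0)"
        using dist by (intro sum_list_distinct_conv_sum_set) (simp add: distinct_map)
      also have "\<dots> = (\<Sum>v'\<in>set ws. if v' = v then u v' else 0)"
        using dist v by (intro sum.cong) (auto simp: distinct_map inj_on_def)
      also have "\<dots> = u v" using v by simp
      finally have wv: "w (t v) = u v" .
      \<comment> \<open>Positivity of the weight excludes the zero vector; the d-th root of the
        weight then recovers the coordinate sum.\<close>
      have "fst v + snd v \<noteq> 0" using w[OF tv] d by (auto simp: wv u_def zero_power)
      then have pos: "fst v + snd v > 0" using nn by linarith
      then have "w (t v) powr (1 / real d) = fst v + snd v"
        unfolding wv u_def by (rule root_power[OF d])
      then show ?thesis using pos by (intro prod_eqI) (simp_all add: V_def t_def field_simps)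
    qed
    then have "map V (map t ws) = ws" by (simp add: map_idI)
    then have "mset ws = image_mset V (mset (map t ws))" by (metis mset_map)
    also have "mset (map t ws) = mset xs"
      using dist xs tws by (subst set_eq_iff_mset_eq_distinct[symmetric]) auto
    finally show ?thesis by simp
  qed
qed

text \<open>The point masses of a finitely supported representing measure solve the moment
  equations, so \<open>uniq\<close> fixes both its support and its masses.\<close>

lemma ex1_atomic_representing_measure:
  assumes R: "finite R" and w: "\<And>x. x \<in> R \<Longrightarrow> w x > 0"
    and y: "\<And>k. k \<le> d \<Longrightarrow> y k = (\<Sum>x\<in>R. w x * x ^ k)"
    and uniq: "\<And>S v. finite S \<Longrightarrow> card S \<le> card R \<Longrightarrow>
      (\<And>k. k \<le> d \<Longrightarrow> y k = (\<Sum>x\<in>S. v x * x ^ k)) \<Longrightarrow> S = R \<and> (\<forall>x\<in>S. v x = w x)"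
  shows "\<exists>!\<mu>. representing d y \<mu> \<and> atomic (card R) \<mu>"
proof (rule ex_ex1I)
  show "\<exists>\<mu>. representing d y \<mu> \<and> atomic (card R) \<mu>"
    using representing_atomic_measure[OF R w y] msupport_atomic_measure[OF R w] R
    by (intro exI[of _ "atomic_measure R w"]) (simp add: atomic_def)
  have *: "msupport \<mu> = R \<and> (\<forall>x\<in>R. measure \<mu> {x} = w x)"
    if "representing d y \<mu>" "atomic (card R) \<mu>" for \<mu>
    using uniq[of "msupport \<mu>" "\<lambda>x. measure \<mu> {x}"] representing_finite_msupport[OF that(1)] that(2)
    by (auto simp: atomic_def)
  fix \<mu> \<nu> assume \<mu>: "representing d y \<mu> \<and> atomic (card R) \<mu>" and \<nu>: "representing d y \<nu> \<and> atomic (card R) \<nu>"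
  show "\<mu> = \<nu>"
  proof (rule measure_eqI_finite_msupport)
    show "sets \<mu> = sets borel" "sets \<nu> = sets borel" using \<mu> \<nu> by (auto simp: representing_def)
    show "finite_measure \<mu>" "finite_measure \<nu>" using \<mu> \<nu> representing_finite_measure by blast+
  qed (use *[of \<mu>] *[of \<nu>] \<mu> \<nu> R in auto)
qed

text \<open>\<open>Poly\<close> discards trailing zeros, so it is injective only among lists of a
  fixed length.\<close>

lemma Poly_eq_iff_same_length: "length xs = length ys \<Longrightarrow> Poly xs = Poly ys \<longleftrightarrow> xs = ys"
  by (metis coeff_Poly_eq nth_default_nth nth_equalityI)

theorem theorem3p2:
  fixes s d :: nat and A :: "nat list \<Rightarrow> real" and y :: "nat \<Rightarrow> real" and r :: nat
  assumes hd: "d = 2 * s + 1"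
    and hA: "sym_tensor d A"
    and hy: "y = Bvec d (LT d A)"
    and hy0: "y 0 > 0"
    and hH3: "psd s (H3 y)"
    and hH4: "psd s (H4 y)"
    and hr: "r = mat_rank s (H1 y)"
  shows
    "(\<exists>!gs :: real list. length gs = r \<and>
        (\<forall>i\<le>d - r. (\<Sum>j<r. y (i + j) * gs ! j) = y (i + r))) \<and>
     (\<forall>gs :: real list. length gs = r \<and>
        (\<forall>i\<le>d - r. (\<Sum>j<r. y (i + j) * gs ! j) = y (i + r)) \<longrightarrow>
        (let g = Poly gs - monom 1 r;
             R = {x. poly g x = 0};
             xs = sorted_list_of_set R
         in finite R \<and> card R = r \<and> R \<subseteq> {0..1} \<and>
            (\<exists>!lams :: real list. length lams = r \<and> (\<forall>l\<in>set lams. l > 0) \<and>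
               (\<forall>k\<le>d. y k = (\<Sum>i<r. lams ! i * (xs ! i) ^ k))) \<and>
            (\<forall>lams :: real list. length lams = r \<and> (\<forall>l\<in>set lams. l > 0) \<and>
               (\<forall>k\<le>d. y k = (\<Sum>i<r. lams ! i * (xs ! i) ^ k)) \<longrightarrow>
               (let vs = map (\<lambda>i. ((lams ! i) powr (1 / real d) * (1 - xs ! i),
                                   (lams ! i) powr (1 / real d) * xs ! i)) [0..<r]
                in A = (\<lambda>zs. \<Sum>v\<leftarrow>vs. tpow d v zs) \<and>
                   (\<forall>v\<in>set vs. fst v \<ge> 0 \<and> snd v \<ge> 0) \<and>
                   cp_rank d A = r \<and>
                   (\<forall>ws. length ws = r \<and> cp_decomp d A ws \<longrightarrow> mset ws = mset vs))))) \<and>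
     (\<exists>!\<mu>. representing d y \<mu> \<and> atomic r \<mu>)"
proof -
  obtain p w where p: "degree p = r" "lead_coeff p = 1" "card {x. poly p x = 0} = r" "{x. poly p x = 0} \<subseteq> {0..1}"
    and w0: "\<And>x. poly p x = 0 \<Longrightarrow> w x > 0"
    and y0: "\<And>k. k \<le> d \<Longrightarrow> y k = (\<Sum>x | poly p x = 0. w x * x ^ k)"
    and sys: "\<And>gs. length gs = r \<Longrightarrow>
      (\<forall>i\<le>d - r. (\<Sum>j<r. y (i + j) * gs ! j) = y (i + r)) \<longleftrightarrow> monom 1 r - Poly gs = p"
    and uniq0: "\<And>S v. finite S \<Longrightarrow> card S \<le> r \<Longrightarrow> (\<And>k. k \<le> d \<Longrightarrow> y k = (\<Sum>x\<in>S. v x * x ^ k)) \<Longrightarrow>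
      S = {x. poly p x = 0} \<and> (\<forall>x\<in>S. v x = w x)"
    using truncated_hausdorff[OF hH3 hH4] unfolding hd hr by blast
  have "p \<noteq> 0" using p(2) by auto
  define R where "R = {x. poly p x = 0}"
  define xs where "xs = sorted_list_of_set R"
  have R: "finite R" "card R = r" "R \<subseteq> {0..1}"
    using p(3,4) \<open>p \<noteq> 0\<close> poly_roots_finite[of p] by (simp_all add: R_def)
  have w: "\<And>x. x \<in> R \<Longrightarrow> w x > 0" using w0 by (simp add: R_def)
  have y: "\<And>k. k \<le> d \<Longrightarrow> y k = (\<Sum>x\<in>R. w x * x ^ k)" using y0 by (simp add: R_def)
  have uniq: "\<And>S v. finite S \<Longrightarrow> card S \<le> card R \<Longrightarrow> (\<And>k. k \<le> d \<Longrightarrow> y k = (\<Sum>x\<in>S. v x * x ^ k)) \<Longrightarrow>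
      S = R \<and> (\<forall>x\<in>S. v x = w x)"
    using uniq0 unfolding R(2) by (simp add: R_def)
  have xs: "distinct xs" "set xs = R" "length xs = r" using R by (simp_all add: xs_def)
  have bij: "bij_betw ((!) xs) {..<r} R" using bij_betw_nth[OF xs(1)] xs by simp
  \<comment> \<open>The solution of the linear system: the coefficients of x^r - p below degree
    r.\<close>
  define gs0 where "gs0 = map (coeff (monom 1 r - p)) [0..<r]"
  have "Poly gs0 = monom 1 r - p"
  proof (rule poly_eqI)
    fix k
    have "coeff (monom 1 r - p) k = 0" if "k \<ge> r"
      using that p(1,2) by (cases "k = r") (auto simp: coeff_eq_0)
    then show "coeff (Poly gs0) k = coeff (monom 1 r - p) k"
      by (cases "k < r") (simp_all add: gs0_def nth_default_def)
  qed
  then have gs_iff: "length gs = r \<and> (\<forall>i\<le>d - r. (\<Sum>j<r. y (i + j) * gs ! j) = y (i + r)) \<longleftrightarrow> gs = gs0" for gs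
    using sys[of gs] Poly_eq_iff_same_length[of gs gs0] by (auto simp: gs0_def algebra_simps)
  have ex: "\<exists>!gs. length gs = r \<and> (\<forall>i\<le>d - r. (\<Sum>j<r. y (i + j) * gs ! j) = y (i + r))"
    unfolding gs_iff by simp
  have roots: "{x. poly (Poly gs - monom 1 r) x = 0} = R"
    if "length gs = r" "\<forall>i\<le>d - r. (\<Sum>j<r. y (i + j) * gs ! j) = y (i + r)" for gs
  proof -
    \<comment> \<open>The polynomial of the statement is - p, which has the same roots.\<close>
    have "p = monom 1 r - Poly gs" using sys that by simp
    then show ?thesis by (auto simp: R_def)
  qed
  have lams_iff: "length lams = r \<and> (\<forall>l\<in>set lams. l > 0) \<and>
      (\<forall>k\<le>d. y k = (\<Sum>i<r. lams ! i * (xs ! i) ^ k)) \<longleftrightarrow> lams = map w xs" for lams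
  proof
    assume lams: "length lams = r \<and> (\<forall>l\<in>set lams. l > 0) \<and>
      (\<forall>k\<le>d. y k = (\<Sum>i<r. lams ! i * (xs ! i) ^ k))"
    \<comment> \<open>Turns the list of weights into a function on the nodes by inverting the
      enumeration \<open>xs\<close>, so that \<open>uniq\<close> can be applied.\<close>
    define v where "v x = lams ! the_inv_into {..<r} ((!) xs) x" for x
    have v: "v (xs ! i) = lams ! i" if "i < r" for i
      using that bij by (simp add: v_def bij_betw_def the_inv_into_f_f)
    have "y k = (\<Sum>x\<in>R. v x * x ^ k)" if "k \<le> d" for k
      using lams that by (simp add: v flip: sum.reindex_bij_betw[OF bij])
    with uniq[OF R(1) order_refl, of v] have "\<forall>x\<in>R. v x = w x" by blast
    then show "lams = map w xs"
      using lams xs v by (intro nth_equalityI) (auto dest: nth_mem)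
  next
    assume "lams = map w xs"
    then show "length lams = r \<and> (\<forall>l\<in>set lams. l > 0) \<and>
      (\<forall>k\<le>d. y k = (\<Sum>i<r. lams ! i * (xs ! i) ^ k))"
      using xs w by (auto simp: y simp flip: sum.reindex_bij_betw[OF bij])
  qed
  define V where "V x = (w x powr (1 / real d) * (1 - x), w x powr (1 / real d) * x)" for x
  have d: "d > 0" using hd by simp
  note cp = cp_rank_unique_decomposition[OF d hA R(1,3) w y[unfolded hy] uniq[unfolded hy] xs(1,2),
      folded V_def, unfolded R(2)]
  have V_nth: "map (\<lambda>i. ((map w xs ! i) powr (1 / real d) * (1 - xs ! i),
      (map w xs ! i) powr (1 / real d) * xs ! i)) [0..<r] = map V xs"
    using xs(3) by (intro nth_equalityI) (simp_all add: V_def)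
  have \<mu>: "\<exists>!\<mu>. representing d y \<mu> \<and> atomic r \<mu>"
    using ex1_atomic_representing_measure[OF R(1) w y uniq] unfolding R(2) by blast
  have decomposition: "A = (\<lambda>zs. \<Sum>v\<leftarrow>map V xs. tpow d v zs) \<and>
      (\<forall>v\<in>set (map V xs). fst v \<ge> 0 \<and> snd v \<ge> 0) \<and> cp_rank d A = r \<and>
      (\<forall>ws. length ws = r \<and> cp_decomp d A ws \<longrightarrow> mset ws = mset (map V xs))"
    using cp unfolding cp_decomp_def[of d A "map V xs"] by blast
  show ?thesis
    unfolding Let_def
  proof (intro conjI ex \<mu>, intro allI impI, elim conjE, goal_cases)
    case (1 gs)
    show ?case
      unfolding roots[OF 1] xs_def[symmetric] lams_iff
    proof (intro conjI R)
      show "\<exists>!lams. lams = map w xs" by simp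
    qed (intro allI impI, hypsubst, unfold V_nth, rule decomposition)
  qed
qed

end
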